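(* Let ${\mathcal C}$ be a subcategory of $\mathbf{Unif}$. Then the following are equivalent: 1) ${\mathcal C}$ is an epireflective subcategory of $\mathbf{Unif}$, closed under bimorphic images. 2) Either $\mathrm{Ob}\,{\mathcal C}=\{X\in \mathrm{Ob}\,\mathbf{Unif}\mid |X|\le 1\}$, or $\mathrm{Ob}\,{\mathcal C}=\{X\in \mathrm{Ob}\,\mathbf{Unif}\mid X\text{ is indiscrete}\}$, or there exists an infinite cardinal $\lambda_0$ such that $\mathrm{Ob}\,{\mathcal C}=\{X\in \mathrm{Ob}\,\mathbf{Unif}\mid X\text{ has covering character at most }\lambda_0\}$, or ${\mathcal C}=\mathbf{Unif}$. Moreover, if 1) is written as the conjunction of the three properties: closedness under products, under extremal subobjects, and under bimorphic images, then none of these three properties can be omitted without invalidating the implication $1)\Rightarrow 2)$ (that is, for each of the three properties there is a subcategory of $\mathbf{Unif}$ having the other two properties but not of the form in 2)).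
   Context: $\mathbf{Unif}$ is the category of all uniform spaces (no separation axiom) and uniformly continuous maps. Subcategories are always full and isomorphism closed, and are identified with the classes of their objects. A subcategory is epireflective if it is reflective with all reflection arrows epimorphisms of the ambient category; in $\mathbf{Unif}$ this is equivalent to being closed under products (including the empty product) and extremal subobjects. In $\mathbf{Unif}$ the epimorphisms are the surjective morphisms, the bimorphisms are the bijective morphisms, and the extremal monomorphisms are the embeddings (so extremal subobjects are the subspaces). For a class $\mathbf{E}$ of epimorphisms, ${\mathcal C}$ is closed under $\mathbf{E}$-images if $C\in\mathrm{Ob}\,{\mathcal C}$ and $e:C\to D$ with $e\in\mathbf{E}$ imply $D\in \mathrm{Ob}\,{\mathcal C}$; bimorphic images correspond to $\mathbf E$ being the class of bimorphisms. The covering character of a uniform space $X$ is the smallest infinite cardinal $\lambda$ such that $X$ admits a base of uniform coverings of cardinalities less than $\lambda$ (equivalently, the smallest infinite cardinal $\lambda$ such that $X$ has no uniformly discrete subspace of cardinality $\lambda$). *)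

theory Defs
  imports Complex_Main "HOL-Library.FuncSet"
begin

unbundle cardinal_syntax

section \<open>Uniform spaces on carrier sets\<close>

text \<open>
  The library class \<open>uniform_space\<close> only covers uniformities on whole types. The following is its
  version for carrier sets, with the same axioms; the uniformity is again the filter of entourages.
  No separation axiom is imposed, and the carrier may be empty (the uniformity is then \<open>bot\<close>).
\<close>

record 'a uspace =
  points :: "'a set"
  unif :: "('a \<times> 'a) filter"

definition unif_space :: "'a uspace \<Rightarrow> bool" where
  "unif_space X \<longleftrightarrow>
     unif X \<le> principal (points X \<times> points X) \<and>
     (\<forall>E. eventually E (unif X) \<longrightarrow> (\<forall>x\<in>points X. E (x, x))) \<and>
     (\<forall>E. eventually E (unif X) \<longrightarrow> eventually (\<lambda>(x, y). E (y, x)) (unif X)) \<and>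
     (\<forall>E. eventually E (unif X) \<longrightarrow>
        (\<exists>D. eventually D (unif X) \<and> (\<forall>x y z. D (x, y) \<longrightarrow> D (y, z) \<longrightarrow> E (x, z))))"

definition indiscrete :: "'a uspace \<Rightarrow> bool" where
  "indiscrete X \<longleftrightarrow> unif X = principal (points X \<times> points X)"

definition uniform_cover :: "'a uspace \<Rightarrow> 'a set set \<Rightarrow> bool" where
  "uniform_cover X \<U> \<longleftrightarrow>
     \<U> \<subseteq> Pow (points X) \<and> \<Union>\<U> = points X \<and>
     (\<exists>E. eventually E (unif X) \<and>
        (\<forall>x\<in>points X. \<exists>U\<in>\<U>. {y \<in> points X. E (x, y)} \<subseteq> U))"

definition refines :: "'a set set \<Rightarrow> 'a set set \<Rightarrow> bool" where
  "refines \<V> \<U> \<longleftrightarrow> (\<forall>V\<in>\<V>. \<exists>U\<in>\<U>. V \<subseteq> U)"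

definition has_cover_base_below :: "'a uspace \<Rightarrow> 'c rel \<Rightarrow> bool" where
  "has_cover_base_below X \<kappa> \<longleftrightarrow>
     (\<exists>\<B>. (\<forall>\<V>\<in>\<B>. uniform_cover X \<V> \<and> |\<V>| <o \<kappa>) \<and>
          (\<forall>\<U>. uniform_cover X \<U> \<longrightarrow> (\<exists>\<V>\<in>\<B>. refines \<V> \<U>)))"

text \<open>
  Cardinals are represented, as in the library, by well-order relations \<open>r\<close> with \<open>Card_order r\<close>;
  \<open>Cinfinite r\<close> says that \<open>r\<close> is an infinite cardinal. Every cardinal up to that of the type \<open>'c\<close>
  is represented by a relation on \<open>'c\<close>, so minimality among relations on \<open>'c\<close> is minimality
  among all cardinals.
\<close>

definition is_covering_character :: "'a uspace \<Rightarrow> 'c rel \<Rightarrow> bool" where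
  "is_covering_character X \<kappa> \<longleftrightarrow>
     Cinfinite \<kappa> \<and> has_cover_base_below X \<kappa> \<and>
     (\<forall>\<mu>::'c rel. Cinfinite \<mu> \<and> has_cover_base_below X \<mu> \<longrightarrow> \<kappa> \<le>o \<mu>)"

definition covering_character_le :: "'a uspace \<Rightarrow> 'c rel \<Rightarrow> bool" where
  "covering_character_le X \<mu> \<longleftrightarrow> (\<exists>\<kappa>::'c rel. is_covering_character X \<kappa> \<and> \<kappa> \<le>o \<mu>)"


section \<open>The category of uniform spaces\<close>

text \<open>
  HOL has no type of all sets, so the universe of sets is a parameter: it is given by an arbitrary
  type \<open>'u\<close>, and the sets of the universe (the small sets) are, up to bijection, those of cardinality
  strictly less than that of \<open>'u\<close>. If the cardinality of \<open>'u\<close> is strongly inaccessible, this is the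
  category of all uniform spaces in a Grothendieck universe.
\<close>

definition small :: "'u set \<Rightarrow> bool" where
  "small A \<longleftrightarrow> |A| <o |UNIV :: 'u set|"

definition Unif :: "'u uspace set" where
  "Unif = {X. unif_space X \<and> small (points X)}"

text \<open>Morphisms are extensional functions, so that equality of morphisms is equality in HOL.\<close>

definition hom :: "'u uspace \<Rightarrow> 'u uspace \<Rightarrow> ('u \<Rightarrow> 'u) set" where
  "hom X Y = {f \<in> points X \<rightarrow>\<^sub>E points Y. filterlim (map_prod f f) (unif Y) (unif X)}"

definition ident :: "'u uspace \<Rightarrow> 'u \<Rightarrow> 'u" where
  "ident X = (\<lambda>x\<in>points X. x)"

definition isomorphism :: "'u uspace \<Rightarrow> 'u uspace \<Rightarrow> ('u \<Rightarrow> 'u) \<Rightarrow> bool" where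
  "isomorphism X Y f \<longleftrightarrow> f \<in> hom X Y \<and>
     (\<exists>g\<in>hom Y X. compose (points X) g f = ident X \<and> compose (points Y) f g = ident Y)"

definition epimorphism :: "'u uspace \<Rightarrow> 'u uspace \<Rightarrow> ('u \<Rightarrow> 'u) \<Rightarrow> bool" where
  "epimorphism X Y f \<longleftrightarrow> f \<in> hom X Y \<and>
     (\<forall>Z\<in>Unif. \<forall>g\<in>hom Y Z. \<forall>h\<in>hom Y Z.
        compose (points X) g f = compose (points X) h f \<longrightarrow> g = h)"

definition monomorphism :: "'u uspace \<Rightarrow> 'u uspace \<Rightarrow> ('u \<Rightarrow> 'u) \<Rightarrow> bool" where
  "monomorphism X Y f \<longleftrightarrow> f \<in> hom X Y \<and>
     (\<forall>Z\<in>Unif. \<forall>g\<in>hom Z X. \<forall>h\<in>hom Z X.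
        compose (points Z) f g = compose (points Z) f h \<longrightarrow> g = h)"

definition bimorphism :: "'u uspace \<Rightarrow> 'u uspace \<Rightarrow> ('u \<Rightarrow> 'u) \<Rightarrow> bool" where
  "bimorphism X Y f \<longleftrightarrow> monomorphism X Y f \<and> epimorphism X Y f"

definition extremal_monomorphism :: "'u uspace \<Rightarrow> 'u uspace \<Rightarrow> ('u \<Rightarrow> 'u) \<Rightarrow> bool" where
  "extremal_monomorphism X Y m \<longleftrightarrow> monomorphism X Y m \<and>
     (\<forall>Z\<in>Unif. \<forall>e g. epimorphism X Z e \<and> g \<in> hom Z Y \<and> m = compose (points X) g e
        \<longrightarrow> isomorphism X Z e)"

definition is_product ::
  "'u set \<Rightarrow> ('u \<Rightarrow> 'u uspace) \<Rightarrow> 'u uspace \<Rightarrow> ('u \<Rightarrow> 'u \<Rightarrow> 'u) \<Rightarrow> bool" where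
  "is_product I X P p \<longleftrightarrow> P \<in> Unif \<and> (\<forall>i\<in>I. p i \<in> hom P (X i)) \<and>
     (\<forall>Y\<in>Unif. \<forall>f. (\<forall>i\<in>I. f i \<in> hom Y (X i)) \<longrightarrow>
        (\<exists>!h. h \<in> hom Y P \<and> (\<forall>i\<in>I. compose (points Y) (p i) h = f i)))"


section \<open>Subcategories\<close>

text \<open>Full, isomorphism-closed subcategories, identified with their classes of objects.\<close>

definition subcategory :: "'u uspace set \<Rightarrow> bool" where
  "subcategory \<C> \<longleftrightarrow> \<C> \<subseteq> Unif \<and>
     (\<forall>X\<in>\<C>. \<forall>Y\<in>Unif. \<forall>f. isomorphism X Y f \<longrightarrow> Y \<in> \<C>)"

definition reflection_arrow ::
  "'u uspace set \<Rightarrow> 'u uspace \<Rightarrow> 'u uspace \<Rightarrow> ('u \<Rightarrow> 'u) \<Rightarrow> bool" where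
  "reflection_arrow \<C> X A r \<longleftrightarrow> A \<in> \<C> \<and> r \<in> hom X A \<and>
     (\<forall>B\<in>\<C>. \<forall>f\<in>hom X B. \<exists>!g. g \<in> hom A B \<and> compose (points X) g r = f)"

definition reflective :: "'u uspace set \<Rightarrow> bool" where
  "reflective \<C> \<longleftrightarrow> (\<forall>X\<in>Unif. \<exists>A r. reflection_arrow \<C> X A r)"

definition epireflective :: "'u uspace set \<Rightarrow> bool" where
  "epireflective \<C> \<longleftrightarrow> reflective \<C> \<and>
     (\<forall>X\<in>Unif. \<forall>A r. reflection_arrow \<C> X A r \<longrightarrow> epimorphism X A r)"

definition closed_under_products :: "'u uspace set \<Rightarrow> bool" where
  "closed_under_products \<C> \<longleftrightarrow>
     (\<forall>I X P p. small I \<and> (\<forall>i\<in>I. X i \<in> \<C>) \<and> is_product I X P p \<longrightarrow> P \<in> \<C>)"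

definition closed_under_extremal_subobjects :: "'u uspace set \<Rightarrow> bool" where
  "closed_under_extremal_subobjects \<C> \<longleftrightarrow>
     (\<forall>Y\<in>\<C>. \<forall>X\<in>Unif. \<forall>m. extremal_monomorphism X Y m \<longrightarrow> X \<in> \<C>)"

definition closed_under_bimorphic_images :: "'u uspace set \<Rightarrow> bool" where
  "closed_under_bimorphic_images \<C> \<longleftrightarrow>
     (\<forall>X\<in>\<C>. \<forall>Y\<in>Unif. \<forall>e. bimorphism X Y e \<longrightarrow> Y \<in> \<C>)"

text \<open>The bound \<open>\<kappa>\<^sub>0 <o |UNIV|\<close> says that \<open>\<kappa>\<^sub>0\<close> is a cardinal of the universe.\<close>

definition listed_form :: "'u uspace set \<Rightarrow> bool" where
  "listed_form \<C> \<longleftrightarrow>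
     \<C> = {X \<in> Unif. finite (points X) \<and> card (points X) \<le> 1} \<or>
     \<C> = {X \<in> Unif. indiscrete X} \<or>
     (\<exists>\<kappa>\<^sub>0 :: 'u rel. Cinfinite \<kappa>\<^sub>0 \<and> \<kappa>\<^sub>0 <o |UNIV :: 'u set| \<and>
        \<C> = {X \<in> Unif. covering_character_le X \<kappa>\<^sub>0}) \<or>
     \<C> = Unif"

end

theory Submission
  imports Defs
begin

text \<open>
  An epireflective subcategory contains every space that carries the initial uniformity for a
  point-separating family of morphisms into it. With one space of more than one point and closure
  under bimorphic images it therefore contains all indiscrete spaces, and with one non-indiscrete
  space all finite discrete ones. Then only the sizes of its discrete members matter: if all of them
  occur, every space is a bimorphic image of a discrete one; otherwise \<open>\<lambda>\<^sub>0\<close> is the least size of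
  a missing discrete space. A space with covering character above \<open>\<lambda>\<^sub>0\<close> has a uniformly discrete
  subspace of size \<open>\<lambda>\<^sub>0\<close>, while one with covering character at most \<open>\<lambda>\<^sub>0\<close> has a uniformity coarser
  than the one generated by the partitions into fewer than \<open>\<lambda>\<^sub>0\<close> classes, which is initial for maps
  into smaller discrete spaces. Conversely, the reflection of a space into the spaces with covering
  character at most \<open>\<lambda>\<^sub>0\<close> is the supremum of its coarser uniformities of this kind.
\<close>

unbundle lattice_syntax

section \<open>Generating uniformities\<close>

text \<open>The initial uniformity on \<open>A\<close> for \<open>f\<close>, as a bare filter. The
  meet with a principal filter confines it to the carrier, so the values of \<open>f\<close> off
  \<open>A\<close> have no influence.\<close>

definition pullback :: "'a set \<Rightarrow> ('a \<Rightarrow> 'b) \<Rightarrow> ('b \<times> 'b) filter \<Rightarrow> ('a \<times> 'a) filter" where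
  "pullback A f G = principal (A \<times> A) \<sqinter> filtercomap (map_prod f f) G"

definition discrete :: "'a set \<Rightarrow> 'a uspace" where
  "discrete A = \<lparr>points = A, unif = principal (Id_on A)\<rparr>"

definition indisc :: "'a set \<Rightarrow> 'a uspace" where
  "indisc A = \<lparr>points = A, unif = principal (A \<times> A)\<rparr>"

lemma discrete_simps [simp]: "points (discrete A) = A" "unif (discrete A) = principal (Id_on A)"
  by (simp_all add: discrete_def)

lemma indisc_simps [simp]: "points (indisc A) = A" "unif (indisc A) = principal (A \<times> A)"
  by (simp_all add: indisc_def)

lemma eventually_pullback:
  "eventually E (pullback A f G) \<longleftrightarrow>
    (\<exists>Q. eventually Q G \<and> (\<forall>x\<in>A. \<forall>y\<in>A. Q (f x, f y) \<longrightarrow> E (x, y)))"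
  unfolding pullback_def inf_commute[of "principal _"] eventually_inf_principal eventually_filtercomap
  by auto

section \<open>Suprema of uniformities\<close>

text \<open>The composition axiom is isolated because it needs an argument of its own for infima;
  the other axioms are comparisons of filters.\<close>

definition transitive_filter :: "('a \<times> 'a) filter \<Rightarrow> bool" where
  "transitive_filter F \<longleftrightarrow> (\<forall>E. eventually E F \<longrightarrow>
     (\<exists>D. eventually D F \<and> (\<forall>x y z. D (x, y) \<longrightarrow> D (y, z) \<longrightarrow> E (x, z))))"

lemma transitive_filterE:
  assumes "transitive_filter F" "eventually E F"
  obtains D where "eventually D F" "\<And>x y z. D (x, y) \<Longrightarrow> D (y, z) \<Longrightarrow> E (x, z)"
  using assms(1)[unfolded transitive_filter_def, rule_format, OF assms(2)] by auto

lemma transitive_filterI: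
  assumes "\<And>E. eventually E F \<Longrightarrow> \<exists>D. eventually D F \<and> (\<forall>x y z. D (x, y) \<longrightarrow> D (y, z) \<longrightarrow> E (x, z))"
  shows "transitive_filter F"
  using assms by (simp add: transitive_filter_def)

lemma eventually_infE:
  assumes "eventually E (F \<sqinter> G)"
  obtains P Q where "eventually P F" "eventually Q G" "\<And>x. P x \<Longrightarrow> Q x \<Longrightarrow> E x"
  using assms[unfolded eventually_inf] by auto

lemma transitive_filter_inf:
  assumes "transitive_filter F" "transitive_filter G"
  shows "transitive_filter (F \<sqinter> G)"
proof (rule transitive_filterI)
  fix E assume "eventually E (F \<sqinter> G)"
  then obtain P Q where P: "eventually P F" and Q: "eventually Q G"
    and PQ: "\<And>p. P p \<Longrightarrow> Q p \<Longrightarrow> E p"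
    by (rule eventually_infE) (rule that)
  obtain P' where P': "eventually P' F" "\<And>x y z. P' (x, y) \<Longrightarrow> P' (y, z) \<Longrightarrow> P (x, z)"
    using transitive_filterE[OF assms(1) P] by metis
  obtain Q' where Q': "eventually Q' G" "\<And>x y z. Q' (x, y) \<Longrightarrow> Q' (y, z) \<Longrightarrow> Q (x, z)"
    using transitive_filterE[OF assms(2) Q] by metis
  have "eventually (\<lambda>p. P' p \<and> Q' p) (F \<sqinter> G)"
    using filter_leD[OF inf_le1 P'(1)] filter_leD[OF inf_le2 Q'(1)] by (rule eventually_conj)
  then show "\<exists>D. eventually D (F \<sqinter> G) \<and> (\<forall>x y z. D (x, y) \<longrightarrow> D (y, z) \<longrightarrow> E (x, z))"
    using P'(2) Q'(2) PQ by (intro exI[of _ "\<lambda>p. P' p \<and> Q' p"] conjI) auto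
qed

text \<open>Every member of an infimum of filters already belongs to the infimum of a finite
  subfamily, so the binary case and induction suffice.\<close>

lemma transitive_filter_INF:
  assumes "\<And>i. i \<in> I \<Longrightarrow> transitive_filter (F i)"
  shows "transitive_filter (\<Sqinter>i\<in>I. F i)"
proof -
  have fin: "transitive_filter (\<Sqinter>i\<in>J. F i)" if "finite J" "J \<subseteq> I" for J
    using that
  proof (induction J rule: finite_induct)
    case empty
    show ?case by (auto simp: transitive_filter_def)
  next
    case (insert j J)
    then show ?case using assms by (simp add: transitive_filter_inf)
  qed
  show ?thesis
  proof (rule transitive_filterI)
    fix E assume "eventually E (\<Sqinter>i\<in>I. F i)"
    from eventually_INF[THEN iffD1, OF this] obtain J
      where J: "J \<subseteq> I" "finite J" "eventually E (\<Sqinter>i\<in>J. F i)"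
      by auto
    then have "transitive_filter (\<Sqinter>i\<in>J. F i)"
      using fin by blast
    then obtain D where D: "eventually D (\<Sqinter>i\<in>J. F i)" "\<And>x y z. D (x, y) \<Longrightarrow> D (y, z) \<Longrightarrow> E (x, z)"
      using J(3) by (rule transitive_filterE) (rule that)
    have "eventually D (\<Sqinter>i\<in>I. F i)"
      by (rule filter_leD[OF INF_superset_mono[OF J(1) order_refl] D(1)])
    then show "\<exists>D. eventually D (\<Sqinter>i\<in>I. F i) \<and> (\<forall>x y z. D (x, y) \<longrightarrow> D (y, z) \<longrightarrow> E (x, z))"
      using D(2) by (intro exI[of _ D] conjI) auto
  qed
qed

lemma unif_space_sym:
  assumes "unif_space X" "eventually E (unif X)"
  shows "eventually (\<lambda>(x, y). E (y, x)) (unif X)"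
  using assms by (simp add: unif_space_def)

lemma unif_space_refl:
  assumes "unif_space X" "eventually E (unif X)" "x \<in> points X"
  shows "E (x, x)"
  using assms(1)[unfolded unif_space_def, THEN conjunct2, THEN conjunct1] assms(2,3) by blast

lemma unif_space_comp:
  assumes "unif_space X" "eventually E (unif X)"
  obtains D where "eventually D (unif X)" "\<And>x y z. D (x, y) \<Longrightarrow> D (y, z) \<Longrightarrow> E (x, z)"
  using assms(1)[unfolded unif_space_def] assms(2) by auto

lemma unif_space_iff:
  "unif_space X \<longleftrightarrow> unif X \<le> principal (points X \<times> points X) \<and>
     principal (Id_on (points X)) \<le> unif X \<and>
     filterlim prod.swap (unif X) (unif X) \<and> transitive_filter (unif X)"
proof -
  have "principal (Id_on (points X)) \<le> unif X \<longleftrightarrow> (\<forall>E. eventually E (unif X) \<longrightarrow> (\<forall>x\<in>points X. E (x, x)))"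
    by (auto simp: le_filter_def eventually_principal)
  moreover have "filterlim prod.swap (unif X) (unif X) \<longleftrightarrow>
      (\<forall>E. eventually E (unif X) \<longrightarrow> eventually (\<lambda>(x, y). E (y, x)) (unif X))"
    by (simp add: filterlim_iff prod.swap_def case_prod_unfold)
  ultimately show ?thesis
    by (simp add: unif_space_def transitive_filter_def)
qed

text \<open>Smaller filters are finer uniformities, so \<open>\<Sqinter>\<close> is the supremum of
  uniformities. The index set is nonempty because the empty infimum \<open>top\<close> is in general
  not confined to \<open>A \<times> A\<close>.\<close>

lemma unif_space_INF:
  assumes "I \<noteq> {}" "\<And>i. i \<in> I \<Longrightarrow> unif_space \<lparr>points = A, unif = F i\<rparr>"
  shows "unif_space \<lparr>points = A, unif = \<Sqinter>i\<in>I. F i\<rparr>"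
proof -
  have "filterlim prod.swap (F i) (\<Sqinter>i\<in>I. F i)" if "i \<in> I" for i
    using assms(2)[OF that] by (intro filterlim_INF'[OF that]) (simp add: unif_space_iff)
  moreover have "(\<Sqinter>i\<in>I. F i) \<le> principal (A \<times> A)"
    using assms by (fastforce simp: unif_space_iff intro: INF_lower2)
  ultimately show ?thesis
    using assms by (auto simp: unif_space_iff filterlim_INF le_INF_iff intro: transitive_filter_INF)
qed

section \<open>Initial, discrete and indiscrete uniformities\<close>

lemma unif_space_pullback:
  assumes "unif_space X" "f ` A \<subseteq> points X"
  shows "unif_space \<lparr>points = A, unif = pullback A f (unif X)\<rparr>"
proof -
  have F: "\<forall>x\<in>A. E (x, x)" "eventually (\<lambda>(x, y). E (y, x)) (pullback A f (unif X))"
    "\<exists>D. eventually D (pullback A f (unif X)) \<and> (\<forall>x y z. D (x, y) \<longrightarrow> D (y, z) \<longrightarrow> E (x, z))"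
    if E: "eventually E (pullback A f (unif X))" for E
  proof -
    obtain Q where Q: "eventually Q (unif X)" "\<forall>x\<in>A. \<forall>y\<in>A. Q (f x, f y) \<longrightarrow> E (x, y)"
      using E unfolding eventually_pullback by blast
    show "\<forall>x\<in>A. E (x, x)"
      using Q(2) unif_space_refl[OF assms(1) Q(1)] assms(2) by blast
    show "eventually (\<lambda>(x, y). E (y, x)) (pullback A f (unif X))"
      unfolding eventually_pullback using unif_space_sym[OF assms(1) Q(1)] Q(2)
      by (intro exI[of _ "\<lambda>(x, y). Q (y, x)"]) simp
    obtain D where D: "eventually D (unif X)" "\<And>x y z. D (x, y) \<Longrightarrow> D (y, z) \<Longrightarrow> Q (x, z)"
      using unif_space_comp[OF assms(1) Q(1)] by metis
    \<comment> \<open>Membership in \<open>A\<close> is built into the half entourage: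
      \<open>Q\<close> controls \<open>E\<close> only at points of \<open>A\<close>, while the
      composition law quantifies over the whole type.\<close>
    have "eventually (\<lambda>(x, y). x \<in> A \<and> y \<in> A \<and> D (f x, f y)) (pullback A f (unif X))"
      unfolding eventually_pullback using D(1) by (intro exI[of _ D]) auto
    then show "\<exists>D. eventually D (pullback A f (unif X)) \<and>
        (\<forall>x y z. D (x, y) \<longrightarrow> D (y, z) \<longrightarrow> E (x, z))"
      using D(2) Q(2) by (intro exI[of _ "\<lambda>(x, y). x \<in> A \<and> y \<in> A \<and> D (f x, f y)"]) fast
  qed
  show ?thesis
    unfolding unif_space_def uspace.simps
    by (intro conjI allI impI; (rule F, assumption)?) (simp add: pullback_def)
qed

text \<open>An equivalence relation is its own half and its own converse.\<close>

lemma unif_space_principal: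
  assumes "equiv A R"
  shows "unif_space \<lparr>points = A, unif = principal R\<rparr>"
proof -
  note R = assms[unfolded equiv_def]
  have "transitive_filter (principal R)"
    using R by (intro transitive_filterI exI[of _ "\<lambda>p. p \<in> R"])
      (auto simp: eventually_principal dest: transD)
  then show ?thesis
    using R by (auto simp: unif_space_iff filterlim_principal eventually_principal
        dest: refl_onD symD)
qed

lemma unif_space_discrete [simp]: "unif_space (discrete A)"
  unfolding discrete_def by (rule unif_space_principal) (auto simp: equiv_def refl_on_def sym_def trans_def)

lemma unif_space_indisc [simp]: "unif_space (indisc A)"
  unfolding indisc_def by (rule unif_space_principal) (auto simp: equiv_def refl_on_def sym_def trans_def)

lemma symmetric_half_entourage:
  assumes "unif_space X" "eventually E (unif X)"
  obtains D where "eventually D (unif X)" "\<And>x y. D (x, y) \<Longrightarrow> D (y, x)"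
    "\<And>x. x \<in> points X \<Longrightarrow> D (x, x)" "\<And>x y z. D (x, y) \<Longrightarrow> D (y, z) \<Longrightarrow> E (x, z)"
proof -
  obtain D where D: "eventually D (unif X)" "\<And>x y z. D (x, y) \<Longrightarrow> D (y, z) \<Longrightarrow> E (x, z)"
    using unif_space_comp[OF assms] by metis
  have "eventually (\<lambda>p. D p \<and> (\<lambda>(x, y). D (y, x)) p) (unif X)"
    using D(1) unif_space_sym[OF assms(1) D(1)] by (rule eventually_conj)
  then show thesis
    by (rule that) (use D(2) unif_space_refl[OF assms(1) D(1)] in auto)
qed

lemma indiscrete_unif_eq:
  assumes "unif_space X" "principal (points X \<times> points X) \<le> unif X"
  shows "indiscrete X"
  using assms by (auto simp: unif_space_def indiscrete_def)

section \<open>Covering characters\<close>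

text \<open>
  For uniformities this is the condition on the covering character (see \<open>covering_character_le_iff\<close>
  below), in a form that visibly passes to suprema.
\<close>

definition few_classes :: "'a set \<Rightarrow> 'c rel \<Rightarrow> ('a \<times> 'a) filter \<Rightarrow> bool" where
  "few_classes A \<kappa> F \<longleftrightarrow> (\<forall>E. eventually E F \<longrightarrow>
     (\<exists>p :: 'a \<Rightarrow> 'a. |p ` A| <o \<kappa> \<and> (\<forall>x\<in>A. \<forall>y\<in>A. p x = p y \<longrightarrow> E (x, y))))"

text \<open>Each value of \<open>f\<close> is replaced by a chosen point of its fibre. Hence labels
  of any type can be turned into labels in the type of the points, the only ones that
  \<open>few_classes\<close> quantifies over.\<close>

lemma same_kernel_endomap:
  fixes f :: "'a \<Rightarrow> 'b"
  obtains q :: "'a \<Rightarrow> 'a" where "|q ` A| \<le>o |f ` A|" "\<And>x y. x \<in> A \<Longrightarrow> y \<in> A \<Longrightarrow> q x = q y \<longleftrightarrow> f x = f y"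
proof
  let ?q = "inv_into A f \<circ> f"
  show "|?q ` A| \<le>o |f ` A|"
    unfolding image_comp[symmetric] by (rule card_of_image)
  show "?q x = ?q y \<longleftrightarrow> f x = f y" if "x \<in> A" "y \<in> A" for x y
    using that by (metis comp_apply f_inv_into_f imageI)
qed

lemma few_classesI:
  assumes "\<And>E. eventually E F \<Longrightarrow>
    \<exists>p :: 'a \<Rightarrow> 'b. |p ` A| <o \<kappa> \<and> (\<forall>x\<in>A. \<forall>y\<in>A. p x = p y \<longrightarrow> E (x, y))"
  shows "few_classes A \<kappa> F"
  unfolding few_classes_def
proof (intro allI impI)
  fix E assume "eventually E F"
  then obtain p :: "'a \<Rightarrow> 'b" where p: "|p ` A| <o \<kappa>" "\<forall>x\<in>A. \<forall>y\<in>A. p x = p y \<longrightarrow> E (x, y)"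
    using assms by blast
  obtain q :: "'a \<Rightarrow> 'a" where "|q ` A| \<le>o |p ` A|" "\<And>x y. x \<in> A \<Longrightarrow> y \<in> A \<Longrightarrow> q x = q y \<longleftrightarrow> p x = p y"
    using same_kernel_endomap[of A p] by blast
  with p show "\<exists>q :: 'a \<Rightarrow> 'a. |q ` A| <o \<kappa> \<and> (\<forall>x\<in>A. \<forall>y\<in>A. q x = q y \<longrightarrow> E (x, y))"
    using ordLeq_ordLess_trans by (intro exI[of _ q]) blast
qed

lemma few_classesD:
  fixes F :: "('a \<times> 'a) filter"
  assumes "few_classes A \<kappa> F" "eventually E F"
  shows "\<exists>p :: 'a \<Rightarrow> 'a. |p ` A| <o \<kappa> \<and> (\<forall>x\<in>A. \<forall>y\<in>A. p x = p y \<longrightarrow> E (x, y))"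
  using assms by (simp add: few_classes_def)

lemma few_classes_pullback:
  fixes f :: "'a \<Rightarrow> 'b"
  assumes "few_classes B \<kappa> G" "f ` A \<subseteq> B"
  shows "few_classes A \<kappa> (pullback A f G)"
proof (rule few_classesI)
  fix E assume "eventually E (pullback A f G)"
  then obtain Q where Q: "eventually Q G" "\<forall>x\<in>A. \<forall>y\<in>A. Q (f x, f y) \<longrightarrow> E (x, y)"
    unfolding eventually_pullback by blast
  obtain p :: "'b \<Rightarrow> 'b" where p: "|p ` B| <o \<kappa>" "\<forall>x\<in>B. \<forall>y\<in>B. p x = p y \<longrightarrow> Q (x, y)"
    using few_classesD[OF assms(1) Q(1)] by blast
  have "|(p \<circ> f) ` A| \<le>o |p ` B|"
    using assms(2) by (intro card_of_mono1) auto
  then have "|(p \<circ> f) ` A| <o \<kappa>"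
    using p(1) ordLeq_ordLess_trans by blast
  moreover have "\<forall>x\<in>A. \<forall>y\<in>A. (p \<circ> f) x = (p \<circ> f) y \<longrightarrow> E (x, y)"
    using p(2) Q(2) assms(2) by (simp add: image_subset_iff)
  ultimately show "\<exists>p :: 'a \<Rightarrow> 'b. |p ` A| <o \<kappa> \<and> (\<forall>x\<in>A. \<forall>y\<in>A. p x = p y \<longrightarrow> E (x, y))"
    by blast
qed

lemma finite_ordLess_Cinfinite: "finite A \<Longrightarrow> Cinfinite \<kappa> \<Longrightarrow> |A| <o \<kappa>"
  using finite_ordLess_infinite[of "|A|" \<kappa>] card_of_Well_order[of A]
  by (auto simp: cinfinite_def card_order_on_def Field_card_of simp del: card_of_well_order_on)

text \<open>If one factor is infinite, the product is no larger than the disjoint sum, and sums stay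
  below an infinite cardinal.\<close>

lemma card_of_Times_ordLess_Cinfinite:
  assumes "|A| <o \<kappa>" "|B| <o \<kappa>" "Cinfinite \<kappa>"
  shows "|A \<times> B| <o \<kappa>"
proof (cases "finite A \<and> finite B")
  case True
  then show ?thesis using assms(3) by (intro finite_ordLess_Cinfinite) auto
next
  case False
  then have "infinite (A <+> B)" by auto
  then have "|A \<times> B| \<le>o |A <+> B|"
    by (intro card_of_Times_ordLeq_infinite_Field card_of_Plus1 card_of_Plus2)
      (simp_all add: Field_card_of card_of_card_order_on)
  moreover have "|A <+> B| <o \<kappa>"
    using assms by (intro card_of_Plus_ordLess_infinite_Field) (auto simp: cinfinite_def)
  ultimately show ?thesis by (rule ordLeq_ordLess_trans)
qed

text \<open>Labelling points by pairs of labels gives the common refinement of two partitions; its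
  size is controlled by the product of two cardinals below \<open>\<kappa>\<close>.\<close>

lemma few_classes_inf:
  fixes A :: "'a set"
  assumes \<kappa>: "Cinfinite \<kappa>" and "few_classes A \<kappa> F" "few_classes A \<kappa> G"
  shows "few_classes A \<kappa> (F \<sqinter> G)"
proof (rule few_classesI)
  fix E assume "eventually E (F \<sqinter> G)"
  then obtain P Q where P: "eventually P F" and Q: "eventually Q G"
    and PQ: "\<And>p. P p \<Longrightarrow> Q p \<Longrightarrow> E p"
    unfolding eventually_inf by blast
  obtain p :: "'a \<Rightarrow> 'a" where p: "|p ` A| <o \<kappa>" "\<forall>x\<in>A. \<forall>y\<in>A. p x = p y \<longrightarrow> P (x, y)"
    using few_classesD[OF assms(2) P] by blast
  obtain q :: "'a \<Rightarrow> 'a" where q: "|q ` A| <o \<kappa>" "\<forall>x\<in>A. \<forall>y\<in>A. q x = q y \<longrightarrow> Q (x, y)"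
    using few_classesD[OF assms(3) Q] by blast
  have "|(\<lambda>x. (p x, q x)) ` A| \<le>o |p ` A \<times> q ` A|"
    by (intro card_of_mono1) auto
  also have "|p ` A \<times> q ` A| <o \<kappa>"
    using p(1) q(1) \<kappa> by (rule card_of_Times_ordLess_Cinfinite)
  finally show "\<exists>p :: 'a \<Rightarrow> 'a \<times> 'a. |p ` A| <o \<kappa> \<and> (\<forall>x\<in>A. \<forall>y\<in>A. p x = p y \<longrightarrow> E (x, y))"
    using p(2) q(2) PQ by (intro exI[of _ "\<lambda>x. (p x, q x)"]) auto
qed

lemma few_classes_INF:
  fixes A :: "'a set"
  assumes \<kappa>: "Cinfinite \<kappa>" and "\<And>i. i \<in> I \<Longrightarrow> few_classes A \<kappa> (F i)"
  shows "few_classes A \<kappa> (\<Sqinter>i\<in>I. F i)"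
proof -
  have fin: "few_classes A \<kappa> (\<Sqinter>i\<in>J. F i)" if "finite J" "J \<subseteq> I" for J
    using that
  proof (induction J rule: finite_induct)
    case empty
    \<comment> \<open>The empty infimum is \<open>top\<close>, whose only member holds everywhere,
      so a constant labelling works.\<close>
    have "|(\<lambda>_. undefined) ` A| <o \<kappa>"
      using \<kappa> by (intro finite_ordLess_Cinfinite) (auto simp: image_constant_conv)
    then show ?case
      by (intro few_classesI exI[of _ "\<lambda>_. undefined"]) auto
  next
    case (insert j J)
    then show ?case using assms by (simp add: few_classes_inf)
  qed
  show ?thesis
    unfolding few_classes_def
  proof (intro allI impI)
    fix E assume "eventually E (\<Sqinter>i\<in>I. F i)"
    from eventually_INF[THEN iffD1, OF this] obtain J
      where "J \<subseteq> I" "finite J" "eventually E (\<Sqinter>i\<in>J. F i)"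
      by auto
    with fin show "\<exists>p :: 'a \<Rightarrow> 'a. |p ` A| <o \<kappa> \<and> (\<forall>x\<in>A. \<forall>y\<in>A. p x = p y \<longrightarrow> E (x, y))"
      unfolding few_classes_def by blast
  qed
qed

section \<open>Small uniform coverings versus small partitions\<close>

lemma has_cover_base_below_iff:
  "has_cover_base_below X \<kappa> \<longleftrightarrow>
    (\<forall>\<U>. uniform_cover X \<U> \<longrightarrow> (\<exists>\<V>. uniform_cover X \<V> \<and> |\<V>| <o \<kappa> \<and> refines \<V> \<U>))"
proof
  assume "\<forall>\<U>. uniform_cover X \<U> \<longrightarrow> (\<exists>\<V>. uniform_cover X \<V> \<and> |\<V>| <o \<kappa> \<and> refines \<V> \<U>)"
  then show "has_cover_base_below X \<kappa>"
    unfolding has_cover_base_below_def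
    by (intro exI[of _ "{\<V>. uniform_cover X \<V> \<and> |\<V>| <o \<kappa>}"]) blast
qed (unfold has_cover_base_below_def, blast)

lemma uniform_cover_balls:
  assumes "unif_space X" "eventually E (unif X)"
  shows "uniform_cover X ((\<lambda>x. {y \<in> points X. E (x, y)}) ` points X)"
  unfolding uniform_cover_def
  using assms(2) unif_space_refl[OF assms] by (intro conjI exI[of _ E]) auto

text \<open>Each point is labelled by a member, containing it, of a small covering that refines the
  balls of a symmetric half \<open>D\<close> of \<open>E\<close>. Points with the same label lie in
  one \<open>D\<close>-ball and are therefore \<open>E\<close>-close.\<close>

lemma few_classes_if_cover_base:
  fixes X :: "'a uspace"
  assumes X: "unif_space X" and "has_cover_base_below X \<kappa>"
  shows "few_classes (points X) \<kappa> (unif X)"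
proof (rule few_classesI)
  fix E assume "eventually E (unif X)"
  then obtain D where D: "eventually D (unif X)" "\<And>x y. D (x, y) \<Longrightarrow> D (y, x)"
    "\<And>x y z. D (x, y) \<Longrightarrow> D (y, z) \<Longrightarrow> E (x, z)"
    by (rule symmetric_half_entourage[OF X]) (rule that)
  obtain \<V> where \<V>: "uniform_cover X \<V>" "|\<V>| <o \<kappa>"
    "refines \<V> ((\<lambda>x. {y \<in> points X. D (x, y)}) ` points X)"
    using assms(2) uniform_cover_balls[OF X D(1)] unfolding has_cover_base_below_iff by blast
  have "\<forall>x\<in>points X. \<exists>V\<in>\<V>. x \<in> V"
    using \<V>(1) unfolding uniform_cover_def by blast
  then obtain p where p: "\<And>x. x \<in> points X \<Longrightarrow> p x \<in> \<V> \<and> x \<in> p x"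
    by metis
  have "|p ` points X| \<le>o |\<V>|"
    using p by (intro card_of_mono1) auto
  then have "|p ` points X| <o \<kappa>"
    using \<V>(2) ordLeq_ordLess_trans by blast
  moreover have "E (x, y)" if xy: "x \<in> points X" "y \<in> points X" "p x = p y" for x y
  proof -
    obtain c where "p x \<subseteq> {y \<in> points X. D (c, y)}"
      using \<V>(3) p[OF xy(1)] unfolding refines_def by force
    then have "D (c, x)" "D (c, y)"
      using p[OF xy(1)] p[OF xy(2)] xy(3) by auto
    then show ?thesis
      using D(2,3) by metis
  qed
  ultimately show "\<exists>p :: 'a \<Rightarrow> 'a set. |p ` points X| <o \<kappa> \<and>
      (\<forall>x\<in>points X. \<forall>y\<in>points X. p x = p y \<longrightarrow> E (x, y))"
    by blast
qed

lemma cover_base_if_few_classes: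
  fixes X :: "'a uspace"
  assumes X: "unif_space X" and "few_classes (points X) \<kappa> (unif X)"
  shows "has_cover_base_below X \<kappa>"
  unfolding has_cover_base_below_iff
proof (intro allI impI)
  fix \<U> assume "uniform_cover X \<U>"
  then obtain E where E: "eventually E (unif X)"
    "\<And>x. x \<in> points X \<Longrightarrow> \<exists>U\<in>\<U>. {y \<in> points X. E (x, y)} \<subseteq> U"
    unfolding uniform_cover_def by blast
  obtain D where D: "eventually D (unif X)" "\<And>x y z. D (x, y) \<Longrightarrow> D (y, z) \<Longrightarrow> E (x, z)"
    "\<And>x. x \<in> points X \<Longrightarrow> D (x, x)"
    using symmetric_half_entourage[OF X E(1)] by metis
  obtain p :: "'a \<Rightarrow> 'a" where p: "|p ` points X| <o \<kappa>"
    "\<forall>x\<in>points X. \<forall>y\<in>points X. p x = p y \<longrightarrow> D (x, y)"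
    using few_classesD[OF assms(2) D(1)] by blast
  \<comment> \<open>The classes of \<open>p\<close> alone need not form a uniform covering.
    Enlarging them by one step of \<open>D\<close> repairs this, and two steps of \<open>D\<close>
    stay inside the \<open>E\<close>-ball of any point of the class.\<close>
  define N where "N c = {y \<in> points X. \<exists>x\<in>points X. p x = c \<and> D (x, y)}" for c
  let ?\<V> = "N ` p ` points X"
  have "|?\<V>| <o \<kappa>"
    using p(1) card_of_image ordLeq_ordLess_trans by blast
  moreover have "uniform_cover X ?\<V>"
    unfolding uniform_cover_def
  proof (intro conjI exI[of _ D] ballI)
    show "?\<V> \<subseteq> Pow (points X)" "\<Union> ?\<V> = points X"
      using D(3) by (auto simp: N_def)
    show "\<exists>V\<in>?\<V>. {y \<in> points X. D (x, y)} \<subseteq> V" if "x \<in> points X" for x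
      using that by (auto simp: N_def)
  qed (rule D(1))
  moreover have "\<exists>U\<in>\<U>. N (p x) \<subseteq> U" if "x \<in> points X" for x
  proof -
    have "N (p x) \<subseteq> {y \<in> points X. E (x, y)}"
      using D(2) p(2) that unfolding N_def by fastforce
    then show ?thesis
      using E(2)[OF that] by blast
  qed
  ultimately show "\<exists>\<V>. uniform_cover X \<V> \<and> |\<V>| <o \<kappa> \<and> refines \<V> \<U>"
    unfolding refines_def by blast
qed

text \<open>Cardinals are well-ordered, so as soon as \<open>\<kappa>\<close> bounds a base of
  coverings there is a least infinite cardinal that does; conversely such a bound passes to every
  larger cardinal.\<close>

lemma covering_character_le_iff:
  fixes \<kappa> :: "'c rel"
  assumes X: "unif_space X" and \<kappa>: "Cinfinite \<kappa>"
  shows "covering_character_le X \<kappa> \<longleftrightarrow> few_classes (points X) \<kappa> (unif X)"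
proof -
  have mono: "has_cover_base_below X \<kappa>" if "has_cover_base_below X \<mu>" "\<mu> \<le>o \<kappa>" for \<mu> :: "'c rel"
    using that ordLess_ordLeq_trans unfolding has_cover_base_below_def by metis
  have "covering_character_le X \<kappa> \<longleftrightarrow> has_cover_base_below X \<kappa>"
  proof
    assume "has_cover_base_below X \<kappa>"
    let ?R = "{\<mu> :: 'c rel. Cinfinite \<mu> \<and> has_cover_base_below X \<mu>}"
    have "\<kappa> \<in> ?R"
      using \<kappa> \<open>has_cover_base_below X \<kappa>\<close> by blast
    then obtain \<mu> where "\<mu> \<in> ?R" "\<forall>\<mu>'\<in>?R. \<mu> \<le>o \<mu>'"
      using exists_minim_Card_order[of ?R] by blast
    then show "covering_character_le X \<kappa>"
      using \<open>\<kappa> \<in> ?R\<close> unfolding covering_character_le_def is_covering_character_def by blast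
  qed (use mono in \<open>auto simp: covering_character_le_def is_covering_character_def\<close>)
  then show ?thesis
    using few_classes_if_cover_base[OF X] cover_base_if_few_classes[OF X] by blast
qed

text \<open>A maximal separated set is a net, so only few classes are needed if it is small.\<close>

lemma large_separated_set:
  assumes X: "unif_space X" and \<kappa>: "Card_order \<kappa>" and "\<not> few_classes (points X) \<kappa> (unif X)"
  obtains S D where "S \<subseteq> points X" "\<kappa> \<le>o |S|" "eventually D (unif X)"
    "\<And>x y. x \<in> S \<Longrightarrow> y \<in> S \<Longrightarrow> D (x, y) \<Longrightarrow> x = y"
proof -
  obtain E where E: "eventually E (unif X)"
    and no: "\<And>p :: 'a \<Rightarrow> 'a. |p ` points X| <o \<kappa> \<Longrightarrow> \<exists>x\<in>points X. \<exists>y\<in>points X. p x = p y \<and> \<not> E (x, y)"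
    using assms(3) unfolding few_classes_def by blast
  obtain D where D: "eventually D (unif X)" "\<And>x y. D (x, y) \<Longrightarrow> D (y, x)"
    "\<And>x. x \<in> points X \<Longrightarrow> D (x, x)" "\<And>x y z. D (x, y) \<Longrightarrow> D (y, z) \<Longrightarrow> E (x, z)"
    using symmetric_half_entourage[OF X E] by metis
  let ?\<S> = "{S. S \<subseteq> points X \<and> (\<forall>x\<in>S. \<forall>y\<in>S. D (x, y) \<longrightarrow> x = y)}"
  have "\<exists>M\<in>?\<S>. \<forall>S\<in>?\<S>. M \<subseteq> S \<longrightarrow> S = M"
  proof (rule subset_Zorn')
    fix \<C> assume "subset.chain ?\<S> \<C>"
    then have sub: "\<C> \<subseteq> ?\<S>" and chain: "\<And>S T. S \<in> \<C> \<Longrightarrow> T \<in> \<C> \<Longrightarrow> S \<subseteq> T \<or> T \<subseteq> S"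
      unfolding subset_chain_def by auto
    have "x = y" if "x \<in> \<Union>\<C>" "y \<in> \<Union>\<C>" "D (x, y)" for x y
    proof -
      obtain S T where "S \<in> \<C>" "x \<in> S" "T \<in> \<C>" "y \<in> T"
        using \<open>x \<in> \<Union>\<C>\<close> \<open>y \<in> \<Union>\<C>\<close> by blast
      then show ?thesis
        using chain[of S T] sub \<open>D (x, y)\<close> by blast
    qed
    then show "\<Union>\<C> \<in> ?\<S>"
      using sub by blast
  qed
  then obtain S where S: "S \<in> ?\<S>" and max: "\<forall>T\<in>?\<S>. S \<subseteq> T \<longrightarrow> T = S"
    by (rule bexE)
  have "\<exists>s. s \<in> S \<and> D (x, s)" if "x \<in> points X" for x
  proof (rule ccontr)
    assume neg: "\<not> (\<exists>s. s \<in> S \<and> D (x, s))"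
    then have "\<not> D (x, s)" "\<not> D (s, x)" if "s \<in> S" for s
      using that D(2)[of s x] by auto
    then have "insert x S \<in> ?\<S>"
      using S that by simp
    then have "insert x S = S"
      using bspec[OF max] by blast
    then show False
      using neg D(3)[OF that] by blast
  qed
  then obtain p where p: "\<forall>x\<in>points X. p x \<in> S \<and> D (x, p x)"
    using bchoice[of "points X" "\<lambda>x s. s \<in> S \<and> D (x, s)"] by auto
  \<comment> \<open>Points sent to the same point of \<open>S\<close> are two steps of
    \<open>D\<close> apart, hence \<open>E\<close>-close, so \<open>no\<close> excludes fewer than
    \<open>\<kappa>\<close> values of \<open>p\<close>.\<close>
  have "\<not> |p ` points X| <o \<kappa>"
  proof
    assume "|p ` points X| <o \<kappa>"
    then obtain x y where xy: "x \<in> points X" "y \<in> points X" "p x = p y" "\<not> E (x, y)"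
      using no by blast
    then have "D (x, p x)" "D (p x, y)"
      using p D(2)[of y "p y"] by auto
    then show False
      using D(4) xy(4) by blast
  qed
  moreover have "|p ` points X| \<le>o |S|"
    using p by (intro card_of_mono1) auto
  ultimately have "\<not> |S| <o \<kappa>"
    using ordLeq_ordLess_trans by blast
  then have "\<kappa> \<le>o |S|"
    using \<kappa>[unfolded card_order_on_def] ordLess_or_ordLeq[of "|S|" \<kappa>] card_of_Well_order by blast
  then show thesis
    by (intro that[of S D] D(1)) (use S in blast)+
qed

section \<open>Morphisms\<close>

lemma pullback_cong: "(\<And>x. x \<in> A \<Longrightarrow> f x = g x) \<Longrightarrow> pullback A f G = pullback A g G"
  by (simp add: filter_eq_iff eventually_pullback)

lemma pullback_restrict: "pullback A (restrict f A) G = pullback A f G"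
  by (rule pullback_cong) simp

lemma pullback_mono: "F \<le> G \<Longrightarrow> pullback A f F \<le> pullback A f G"
  unfolding pullback_def by (intro inf_mono filtercomap_mono order_refl)

lemma pullback_le_principal: "pullback A f G \<le> principal (A \<times> A)"
  by (simp add: pullback_def)

lemma pullback_pullback:
  assumes "f ` A \<subseteq> B"
  shows "pullback A f (pullback B g G) = pullback A (\<lambda>x. g (f x)) G"
proof -
  have "A \<times> A \<inter> map_prod f f -` (B \<times> B) = A \<times> A"
    using assms by (auto simp: image_subset_iff)
  then show ?thesis
    by (simp add: pullback_def filtercomap_inf filtercomap_filtercomap map_prod_def case_prod_unfold
        flip: inf_assoc)
qed

lemma pullback_indisc: "f ` A \<subseteq> B \<Longrightarrow> pullback A f (principal (B \<times> B)) = principal (A \<times> A)"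
  by (auto simp: pullback_def image_subset_iff intro!: arg_cong[of _ _ principal])

lemma pullback_id:
  fixes X :: "'a uspace"
  assumes "unif_space X"
  shows "pullback (points X) (\<lambda>x. x) (unif X) = unif X"
proof -
  have "unif X \<le> principal (points X \<times> points X)"
    using assms unif_space_def by blast
  moreover have "map_prod (\<lambda>x. x) (\<lambda>x. x) = (\<lambda>p :: 'a \<times> 'a. p)"
    by auto
  ultimately show ?thesis
    by (simp add: pullback_def inf_absorb2 filtercomap_ident)
qed

lemma unif_space_le_principal: "unif_space X \<Longrightarrow> unif X \<le> principal (points X \<times> points X)"
  unfolding unif_space_def by (rule conjunct1)

text \<open>Uniform continuity becomes a comparison of filters on the source, so that morphisms can
  be handled by lattice arguments.\<close>

lemma hom_iff:
  assumes "unif_space X"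
  shows "f \<in> hom X Y \<longleftrightarrow>
    f \<in> points X \<rightarrow>\<^sub>E points Y \<and> unif X \<le> pullback (points X) f (unif Y)"
  using assms by (simp add: hom_def pullback_def filterlim_iff_le_filtercomap unif_space_le_principal)

lemma hom_points: "f \<in> hom X Y \<Longrightarrow> x \<in> points X \<Longrightarrow> f x \<in> points Y"
  by (auto simp: hom_def)

lemma hom_image: "f \<in> hom X Y \<Longrightarrow> f ` points X \<subseteq> points Y"
  by (auto simp: hom_def)

lemma hom_extensional: "f \<in> hom X Y \<Longrightarrow> f \<in> extensional (points X)"
  by (auto simp: hom_def PiE_def)

lemma hom_eqI:
  assumes "f \<in> hom X Y" "g \<in> hom X Z" "\<And>x. x \<in> points X \<Longrightarrow> f x = g x"
  shows "f = g"
  using assms hom_extensional by (intro extensionalityI[of f "points X" g]) auto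

lemma hom_eventually:
  "f \<in> hom X Y \<Longrightarrow> eventually E (unif Y) \<Longrightarrow> eventually (\<lambda>(x, y). E (f x, f y)) (unif X)"
  by (simp add: hom_def filterlim_iff map_prod_def case_prod_unfold)

lemma restrict_hom:
  assumes "unif_space X" "f ` points X \<subseteq> points Y"
    "unif X \<le> pullback (points X) f (unif Y)"
  shows "restrict f (points X) \<in> hom X Y"
  using assms pullback_cong[of "points X" "restrict f (points X)" f]
  by (auto simp: hom_iff)

lemma restrict_hom_indisc:
  assumes "unif_space X" "f ` points X \<subseteq> B"
  shows "restrict f (points X) \<in> hom X (indisc B)"
  using assms by (intro restrict_hom) (auto simp: pullback_indisc unif_space_le_principal)

text \<open>Reflexivity of the pulled back uniformity says exactly that it lies above the discrete
  one.\<close>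

lemma restrict_hom_discrete:
  assumes "unif_space Y" "f ` A \<subseteq> points Y"
  shows "restrict f A \<in> hom (discrete A) Y"
proof -
  have "principal (Id_on A) \<le> pullback A f (unif Y)"
    using unif_space_pullback[OF assms] by (simp add: unif_space_iff)
  then show ?thesis
    using restrict_hom[of "discrete A" f Y] assms by simp
qed

lemma compose_hom:
  assumes "unif_space X" "f \<in> hom X Y" "g \<in> hom Y Z"
  shows "compose (points X) g f \<in> hom X Z"
  unfolding compose_def
proof (rule restrict_hom)
  show "unif X \<le> pullback (points X) (\<lambda>x. g (f x)) (unif Z)"
    using filterlim_compose[of "map_prod g g" "unif Z" "unif Y" "map_prod f f" "unif X"] assms
    by (simp add: hom_def pullback_def filterlim_iff_le_filtercomap unif_space_le_principal
        map_prod_def case_prod_unfold)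
qed (use assms in \<open>auto simp: hom_def\<close>)

section \<open>Small sets, and special morphisms described by points\<close>

lemma small_finite: "infinite (UNIV :: 'u set) \<Longrightarrow> finite A \<Longrightarrow> small (A :: 'u set)"
  unfolding small_def by (intro finite_ordLess_Cinfinite) (simp_all add: cinfinite_def Field_card_of card_of_card_order_on)

lemma small_if_ordLeq: "|A :: 'u set| \<le>o |B :: 'u set| \<Longrightarrow> small B \<Longrightarrow> small A"
  unfolding small_def by (rule ordLeq_ordLess_trans)

lemma small_subset: "A \<subseteq> B \<Longrightarrow> small B \<Longrightarrow> small A"
  by (rule small_if_ordLeq[OF card_of_mono1])

lemma UnifD: "X \<in> Unif \<Longrightarrow> unif_space X" "X \<in> Unif \<Longrightarrow> small (points X)"
  by (auto simp: Unif_def)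

lemma discrete_Unif [simp]: "discrete A \<in> Unif \<longleftrightarrow> small A"
  by (simp add: Unif_def)

lemma indisc_Unif [simp]: "indisc A \<in> Unif \<longleftrightarrow> small A"
  by (simp add: Unif_def)

text \<open>Points of \<open>X\<close> are morphisms from a one-point space, so a monomorphism
  cannot identify two of them.\<close>

lemma monomorphism_iff_inj:
  fixes X :: "'u uspace"
  assumes inf: "infinite (UNIV :: 'u set)" and X: "unif_space X"
  shows "monomorphism X Y f \<longleftrightarrow> f \<in> hom X Y \<and> inj_on f (points X)"
proof
  assume f: "monomorphism X Y f"
  have "x = y" if "x \<in> points X" "y \<in> points X" "f x = f y" for x y
  proof -
    let ?Z = "discrete {x}"
    have "restrict (\<lambda>_. x) {x} \<in> hom ?Z X" "restrict (\<lambda>_. y) {x} \<in> hom ?Z X"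
      using that X by (auto intro!: restrict_hom_discrete)
    moreover have "compose (points ?Z) f (restrict (\<lambda>_. x) {x}) =
        compose (points ?Z) f (restrict (\<lambda>_. y) {x})"
      using that by (simp add: compose_def fun_eq_iff)
    moreover have "?Z \<in> Unif"
      using small_finite[OF inf] by simp
    ultimately have "restrict (\<lambda>_. x) {x} = restrict (\<lambda>_. y) {x}"
      using f unfolding monomorphism_def by blast
    from fun_cong[OF this, of x] show ?thesis
      by simp
  qed
  with f show "f \<in> hom X Y \<and> inj_on f (points X)"
    by (auto simp: monomorphism_def inj_on_def)
next
  assume f: "f \<in> hom X Y \<and> inj_on f (points X)"
  have "g = h" if "g \<in> hom Z X" "h \<in> hom Z X"
    "compose (points Z) f g = compose (points Z) f h" for Z g h
  proof (rule hom_eqI[OF that(1,2)])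
    fix z assume "z \<in> points Z"
    then have "f (g z) = f (h z)" "g z \<in> points X" "h z \<in> points X"
      using fun_cong[OF that(3), of z] that(1,2) by (simp_all add: compose_def hom_points)
    then show "g z = h z"
      using f by (auto dest: inj_onD)
  qed
  with f show "monomorphism X Y f"
    unfolding monomorphism_def by blast
qed

text \<open>If \<open>f\<close> misses \<open>y\<close>, a constant map and a map differing from it
  only at \<open>y\<close> agree after \<open>f\<close>. With an indiscrete two-point target both
  are morphisms.\<close>

lemma epimorphism_iff_surj:
  fixes X :: "'u uspace"
  assumes inf: "infinite (UNIV :: 'u set)" and Y: "unif_space Y"
  shows "epimorphism X Y f \<longleftrightarrow> f \<in> hom X Y \<and> f ` points X = points Y"
proof
  assume f: "epimorphism X Y f"
  then have hom: "f \<in> hom X Y"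
    by (simp add: epimorphism_def)
  have "points Y \<subseteq> f ` points X"
  proof
    fix y assume y: "y \<in> points Y"
    show "y \<in> f ` points X"
    proof (rule ccontr)
      assume "y \<notin> f ` points X"
      obtain a b :: 'u where "a \<noteq> b"
        using ex_new_if_finite[OF inf, of "{undefined}"] by auto
      let ?Z = "indisc {a, b}"
      let ?g = "restrict (\<lambda>_. a) (points Y)" and ?h = "restrict (\<lambda>z. if z = y then b else a) (points Y)"
      have "?g \<in> hom Y ?Z" "?h \<in> hom Y ?Z"
        using Y by (auto intro!: restrict_hom_indisc)
      moreover have "compose (points X) ?g f = compose (points X) ?h f"
        using hom_points[OF hom] \<open>y \<notin> f ` points X\<close> by (auto simp: compose_def fun_eq_iff)
      moreover have "?Z \<in> Unif"
        using small_finite[OF inf] by simp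
      ultimately have "?g = ?h"
        using f unfolding epimorphism_def by blast
      from fun_cong[OF this, of y] show False
        using y \<open>a \<noteq> b\<close> by simp
    qed
  qed
  then show "f \<in> hom X Y \<and> f ` points X = points Y"
    using hom hom_image by blast
next
  assume f: "f \<in> hom X Y \<and> f ` points X = points Y"
  have "g = h" if "g \<in> hom Y Z" "h \<in> hom Y Z"
    "compose (points X) g f = compose (points X) h f" for Z g h
  proof (rule hom_eqI[OF that(1,2)])
    fix y assume "y \<in> points Y"
    then obtain x where "x \<in> points X" "y = f x"
      using f by blast
    then show "g y = h y"
      using fun_cong[OF that(3), of x] by (simp add: compose_def)
  qed
  with f show "epimorphism X Y f"
    unfolding epimorphism_def by blast
qed

lemma bimorphism_iff_bij:
  fixes X :: "'u uspace"
  assumes "infinite (UNIV :: 'u set)" "unif_space X" "unif_space Y"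
  shows "bimorphism X Y f \<longleftrightarrow> f \<in> hom X Y \<and> bij_betw f (points X) (points Y)"
  using assms by (auto simp: bimorphism_def monomorphism_iff_inj epimorphism_iff_surj bij_betw_def)

lemma isomorphism_bij:
  assumes "isomorphism X Y f"
  shows "f \<in> hom X Y" "bij_betw f (points X) (points Y)"
proof -
  obtain g where f: "f \<in> hom X Y" and g: "g \<in> hom Y X"
    and gf: "compose (points X) g f = ident X" and fg: "compose (points Y) f g = ident Y"
    using assms unfolding isomorphism_def by blast
  show "f \<in> hom X Y" by (rule f)
  have "g (f x) = x" if "x \<in> points X" for x
    using fun_cong[OF gf, of x] that by (simp add: compose_def ident_def)
  moreover have "f (g y) = y" if "y \<in> points Y" for y
    using fun_cong[OF fg, of y] that by (simp add: compose_def ident_def)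
  ultimately show "bij_betw f (points X) (points Y)"
    using hom_image[OF f] hom_image[OF g] by (intro bij_betw_byWitness[where f' = g]) auto
qed

text \<open>Initiality of the source uniformity makes the inverse bijection uniformly continuous.
  The isomorphism points from \<open>Y\<close> to \<open>X\<close> because isomorphism-closedness is
  later applied from a reflection back to the reflected space.\<close>

lemma isomorphism_inverse:
  assumes X: "unif_space X" and Y: "unif_space Y"
    and f: "f \<in> hom X Y" "bij_betw f (points X) (points Y)"
    and init: "pullback (points X) f (unif Y) \<le> unif X"
  shows "isomorphism Y X (restrict (inv_into (points X) f) (points Y))"
proof -
  let ?g = "inv_into (points X) f"
  have g: "?g ` points Y \<subseteq> points X" "\<And>y. y \<in> points Y \<Longrightarrow> f (?g y) = y"
    "\<And>x. x \<in> points X \<Longrightarrow> ?g (f x) = x"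
    using f(2) by (auto simp: bij_betw_def inv_into_into f_inv_into_f)
  have "unif Y = pullback (points Y) (\<lambda>y. f (?g y)) (unif Y)"
    using pullback_id[OF Y] g(2) pullback_cong[of "points Y" "\<lambda>y. f (?g y)" "\<lambda>y. y"] by simp
  also have "\<dots> = pullback (points Y) ?g (pullback (points X) f (unif Y))"
    using pullback_pullback[OF g(1), of f] by simp
  also have "\<dots> \<le> pullback (points Y) ?g (unif X)"
    by (rule pullback_mono[OF init])
  finally have "restrict ?g (points Y) \<in> hom Y X"
    using Y g(1) by (intro restrict_hom) auto
  moreover have "compose (points Y) f (restrict ?g (points Y)) = ident Y"
    using g(2) by (auto simp: compose_def ident_def fun_eq_iff)
  moreover have "compose (points X) (restrict ?g (points Y)) f = ident X"
    using g(3) hom_points[OF f(1)] by (auto simp: compose_def ident_def fun_eq_iff)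
  ultimately show ?thesis
    using f(1) unfolding isomorphism_def by blast
qed

text \<open>The identity on points from a uniformity to a coarser one is a bimorphism; the
  classification uses closure under bimorphic images in this form.\<close>

lemma bimorphic_image_mem:
  fixes C :: "'u uspace set"
  assumes inf: "infinite (UNIV :: 'u set)" and C: "subcategory C" "closed_under_bimorphic_images C"
    and "X \<in> C" "unif_space Y" "points Y = points X" "unif X \<le> unif Y"
  shows "Y \<in> C"
proof -
  have X: "X \<in> Unif" "unif_space X"
    using C(1) \<open>X \<in> C\<close> UnifD(1) unfolding subcategory_def by blast+
  then have "Y \<in> Unif"
    using assms(5,6) by (simp add: Unif_def)
  have "unif X \<le> pullback (points X) (\<lambda>x. x) (unif Y)"
    using pullback_id[OF assms(5)] assms(6,7) by simp
  then have "restrict (\<lambda>x. x) (points X) \<in> hom X Y"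
    using X assms(6) by (intro restrict_hom) auto
  then have "bimorphism X Y (restrict (\<lambda>x. x) (points X))"
    using inf X assms(5,6) by (auto simp: bimorphism_iff_bij bij_betw_def inj_on_def)
  then show ?thesis
    using C(2) \<open>X \<in> C\<close> \<open>Y \<in> Unif\<close> unfolding closed_under_bimorphic_images_def by blast
qed

section \<open>Epireflective subcategories\<close>

text \<open>
  A space whose uniformity and points are determined by its morphisms into \<open>C\<close> is isomorphic to its
  reflection. This takes the place of embeddings into products, which need not exist in \<open>Unif\<close>
  when the universe is not strongly inaccessible.
\<close>

lemma epireflective_mem:
  fixes C :: "'u uspace set"
  assumes inf: "infinite (UNIV :: 'u set)" and C: "subcategory C" "epireflective C"
    and X: "X \<in> Unif"
    and sep: "\<And>x y. x \<in> points X \<Longrightarrow> y \<in> points X \<Longrightarrow> x \<noteq> y \<Longrightarrow> \<exists>B\<in>C. \<exists>f\<in>hom X B. f x \<noteq> f y"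
    and init: "\<And>F. F \<le> principal (points X \<times> points X) \<Longrightarrow>
      (\<And>B f. B \<in> C \<Longrightarrow> f \<in> hom X B \<Longrightarrow> F \<le> pullback (points X) f (unif B)) \<Longrightarrow> F \<le> unif X"
  shows "X \<in> C"
proof -
  obtain A r where r: "reflection_arrow C X A r"
    using C(2) X unfolding epireflective_def reflective_def by blast
  then have A: "A \<in> C" "r \<in> hom X A"
    by (auto simp: reflection_arrow_def)
  have fact: "\<exists>g\<in>hom A B. \<forall>x\<in>points X. g (r x) = f x" if f: "B \<in> C" "f \<in> hom X B" for B f
  proof -
    obtain g where g: "g \<in> hom A B" "compose (points X) g r = f"
      using r f unfolding reflection_arrow_def by blast
    then show ?thesis
      by (auto simp: compose_def)
  qed
  have us: "unif_space X" "unif_space A"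
    using X A(1) C(1) UnifD(1) unfolding subcategory_def by blast+
  have "epimorphism X A r"
    using C(2) X r unfolding epireflective_def by blast
  then have "r ` points X = points A"
    using epimorphism_iff_surj[OF inf us(2)] by blast
  moreover have "x = y" if xy: "x \<in> points X" "y \<in> points X" "r x = r y" for x y
  proof (rule ccontr)
    assume "x \<noteq> y"
    then obtain B f where f: "B \<in> C" "f \<in> hom X B" "f x \<noteq> f y"
      using sep[OF xy(1,2)] by blast
    obtain g where "\<forall>x\<in>points X. g (r x) = f x"
      using fact[OF f(1,2)] by blast
    then show False
      using f(3) xy by (metis)
  qed
  ultimately have bij: "bij_betw r (points X) (points A)"
    by (simp add: bij_betw_def inj_on_def)
  \<comment> \<open>Every morphism \<open>f\<close> into \<open>C\<close> is \<open>g\<close> after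
    \<open>r\<close> for some morphism \<open>g\<close>, so the filter pulled back along
    \<open>r\<close> lies below the one pulled back along \<open>f\<close>, as \<open>init\<close>
    requires.\<close>
  have "pullback (points X) r (unif A) \<le> unif X"
  proof (rule init[OF pullback_le_principal])
    fix B f assume f: "B \<in> C" "f \<in> hom X B"
    obtain g where g: "g \<in> hom A B" "\<forall>x\<in>points X. g (r x) = f x"
      using fact[OF f] by blast
    have "pullback (points X) r (unif A) \<le> pullback (points X) r (pullback (points A) g (unif B))"
      using g(1) us(2) by (intro pullback_mono) (simp add: hom_iff)
    also have "\<dots> = pullback (points X) (\<lambda>x. g (r x)) (unif B)"
      by (rule pullback_pullback[OF hom_image[OF A(2)]])
    also have "\<dots> = pullback (points X) f (unif B)"
      by (rule pullback_cong) (use g(2) in blast)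
    finally show "pullback (points X) r (unif A) \<le> pullback (points X) f (unif B)" .
  qed
  then have "isomorphism A X (restrict (inv_into (points X) r) (points A))"
    by (rule isomorphism_inverse[OF us A(2) bij])
  then show ?thesis
    using C(1) A(1) X unfolding subcategory_def by blast
qed

lemma epireflective_embedding_mem:
  fixes C :: "'u uspace set"
  assumes "infinite (UNIV :: 'u set)" "subcategory C" "epireflective C" "X \<in> Unif"
    and B: "B \<in> C" "f \<in> hom X B" "inj_on f (points X)"
    and "pullback (points X) f (unif B) \<le> unif X"
  shows "X \<in> C"
proof (rule epireflective_mem[OF assms(1-4)])
  show "\<exists>B\<in>C. \<exists>f\<in>hom X B. f x \<noteq> f y" if "x \<in> points X" "y \<in> points X" "x \<noteq> y" for x y
    using B that by (meson inj_onD)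
  show "F \<le> unif X" if "\<And>B f. B \<in> C \<Longrightarrow> f \<in> hom X B \<Longrightarrow> F \<le> pullback (points X) f (unif B)" for F
    using that[OF B(1,2)] assms(8) by order
qed

section \<open>Subspaces, and discrete or indiscrete members\<close>

lemma epireflective_subspace_mem:
  fixes C :: "'u uspace set"
  assumes inf: "infinite (UNIV :: 'u set)" and C: "subcategory C" "epireflective C"
    and "X \<in> C" "S \<subseteq> points X"
  shows "\<lparr>points = S, unif = pullback S (\<lambda>x. x) (unif X)\<rparr> \<in> C"
proof -
  let ?S = "\<lparr>points = S, unif = pullback S (\<lambda>x. x) (unif X)\<rparr>"
  have X: "unif_space X" "small (points X)"
    using C(1) assms(4) UnifD unfolding subcategory_def by blast+
  have S: "unif_space ?S"
    using unif_space_pullback[of X "\<lambda>x. x" S] X(1) assms(5) by simp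
  show ?thesis
  proof (rule epireflective_embedding_mem[OF inf C])
    show "?S \<in> Unif"
      using S small_subset[OF assms(5) X(2)] by (simp add: Unif_def)
    show "restrict (\<lambda>x. x) S \<in> hom ?S X"
      using restrict_hom[OF S, of "\<lambda>x. x" X] assms(5) by simp
    show "pullback (points ?S) (restrict (\<lambda>x. x) S) (unif X) \<le> unif ?S"
      using pullback_cong[of S "restrict (\<lambda>x. x) S" "\<lambda>x. x"] by simp
  qed (simp_all add: assms(4) inj_on_def)
qed

text \<open>The entourage \<open>D\<close> meets \<open>S \<times> S\<close> only in the diagonal,
  so the subspace uniformity on \<open>S\<close> is the discrete one.\<close>

lemma epireflective_discrete_mem:
  fixes C :: "'u uspace set"
  assumes inf: "infinite (UNIV :: 'u set)" and C: "subcategory C" "epireflective C"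
    and "X \<in> C" "S \<subseteq> points X" "eventually D (unif X)"
    and sep: "\<And>x y. x \<in> S \<Longrightarrow> y \<in> S \<Longrightarrow> D (x, y) \<Longrightarrow> x = y"
  shows "discrete S \<in> C"
proof -
  let ?S = "\<lparr>points = S, unif = pullback S (\<lambda>x. x) (unif X)\<rparr>"
  have "?S \<in> C"
    by (rule epireflective_subspace_mem[OF inf C assms(4,5)])
  then have "unif_space ?S"
    using C(1) UnifD unfolding subcategory_def by blast
  have "eventually (\<lambda>p. p \<in> Id_on S) (pullback S (\<lambda>x. x) (unif X))"
    unfolding eventually_pullback using sep assms(6) by (intro exI[of _ D]) auto
  then have "pullback S (\<lambda>x. x) (unif X) \<le> principal (Id_on S)"
    by (simp add: le_principal)
  moreover have "principal (Id_on S) \<le> pullback S (\<lambda>x. x) (unif X)"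
    using \<open>unif_space ?S\<close> by (simp add: unif_space_iff)
  ultimately have "discrete S = ?S"
    by (simp add: discrete_def)
  then show ?thesis
    using \<open>?S \<in> C\<close> by simp
qed

lemma epireflective_discrete_mono:
  fixes C :: "'u uspace set"
  assumes inf: "infinite (UNIV :: 'u set)" and C: "subcategory C" "epireflective C"
    and "discrete B \<in> C" "|A| \<le>o |B|"
  shows "discrete A \<in> C"
proof -
  obtain f where f: "inj_on f A" "f ` A \<subseteq> B"
    using card_of_ordLeq[THEN iffD2, OF assms(5)] by auto
  have "small A"
    using assms(4) C(1) small_if_ordLeq[OF assms(5)] by (auto simp: subcategory_def)
  show ?thesis
  proof (rule epireflective_embedding_mem[OF inf C])
    show "restrict f A \<in> hom (discrete A) (discrete B)"
      using f by (intro restrict_hom_discrete) auto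
    show "pullback (points (discrete A)) (restrict f A) (unif (discrete B)) \<le> unif (discrete A)"
      using f by (auto simp: pullback_def inj_on_def)
  qed (use f \<open>small A\<close> assms(4) in \<open>auto simp: inj_on_def\<close>)
qed

text \<open>The two-valued maps \<open>\<chi> z\<close> that single out a point \<open>z\<close> are
  initial for the discrete uniformity: finiteness of \<open>A\<close> allows the entourages of all
  of them to be intersected.\<close>

lemma epireflective_finite_discrete_mem:
  fixes C :: "'u uspace set"
  assumes inf: "infinite (UNIV :: 'u set)" and C: "subcategory C" "epireflective C"
    and ab: "discrete {a, b} \<in> C" "a \<noteq> b" and "finite A"
  shows "discrete A \<in> C"
proof -
  define \<chi> where "\<chi> z = restrict (\<lambda>w. if w = z then a else b) A" for z
  have \<chi>: "\<chi> z \<in> hom (discrete A) (discrete {a, b})" for z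
    unfolding \<chi>_def by (rule restrict_hom_discrete) auto
  show ?thesis
  proof (rule epireflective_mem[OF inf C])
    show "discrete A \<in> Unif"
      using small_finite[OF inf assms(6)] by simp
    show "\<exists>B\<in>C. \<exists>f\<in>hom (discrete A) B. f x \<noteq> f y"
      if "x \<in> points (discrete A)" "y \<in> points (discrete A)" "x \<noteq> y" for x y
      using that ab(2) by (intro bexI[OF _ ab(1)] bexI[OF _ \<chi>[of x]]) (simp add: \<chi>_def)
    fix F assume F: "F \<le> principal (points (discrete A) \<times> points (discrete A))"
      and "\<And>B f. B \<in> C \<Longrightarrow> f \<in> hom (discrete A) B \<Longrightarrow> F \<le> pullback (points (discrete A)) f (unif B)"
    then have "F \<le> pullback A (\<chi> z) (principal (Id_on {a, b}))" for z
      using \<chi> ab(1) by fastforce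
    moreover have "eventually (\<lambda>(x, y). x \<in> A \<and> y \<in> A \<and> \<chi> z x = \<chi> z y)
        (pullback A (\<chi> z) (principal (Id_on {a, b})))" for z
      unfolding eventually_pullback
      by (intro exI[of _ "\<lambda>p. p \<in> Id_on {a, b}"]) (auto simp: eventually_principal)
    ultimately have "eventually (\<lambda>(x, y). x \<in> A \<and> y \<in> A \<and> \<chi> z x = \<chi> z y) F" for z
      using filter_leD by blast
    then have "eventually (\<lambda>p. \<forall>z\<in>A. case p of (x, y) \<Rightarrow> x \<in> A \<and> y \<in> A \<and> \<chi> z x = \<chi> z y) F"
      using assms(6) by (intro eventually_ball_finite) auto
    moreover have "eventually (\<lambda>p. p \<in> A \<times> A) F"
      using F by (simp add: le_principal)
    ultimately have "eventually (\<lambda>p. p \<in> Id_on A) F"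
      by eventually_elim (use ab(2) in \<open>auto simp: \<chi>_def split: if_splits\<close>)
    then show "F \<le> unif (discrete A)"
      by (simp add: le_principal)
  qed
qed

text \<open>On at most one point the finest and the coarsest uniformity coincide, so the initiality
  condition is automatic and separation is vacuous. The empty space is included.\<close>

lemma epireflective_subsingleton_mem:
  fixes C :: "'u uspace set"
  assumes inf: "infinite (UNIV :: 'u set)" and C: "subcategory C" "epireflective C"
    and X: "X \<in> Unif" "finite (points X)" "card (points X) \<le> 1"
  shows "X \<in> C"
proof -
  have eq: "x = y" if "x \<in> points X" "y \<in> points X" for x y
    using X(2,3) that card_le_Suc0_iff_eq[of "points X"] by simp
  then have "points X \<times> points X \<subseteq> Id_on (points X)"
    by auto
  then have "principal (points X \<times> points X) \<le> unif X"
    using UnifD(1)[OF X(1)] unfolding unif_space_iff by (auto intro: order_trans)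
  then show ?thesis
    using eq by (intro epireflective_mem[OF inf C X(1)]) (auto intro: order_trans)
qed

lemma epireflective_bimorphic_indiscrete_mem:
  fixes C :: "'u uspace set"
  assumes inf: "infinite (UNIV :: 'u set)" and C: "subcategory C" "epireflective C"
    and bi: "closed_under_bimorphic_images C"
    and X: "X \<in> C" "x \<in> points X" "y \<in> points X" "x \<noteq> y"
    and Y: "Y \<in> Unif" "indiscrete Y"
  shows "Y \<in> C"
proof -
  let ?S = "\<lparr>points = {x, y}, unif = pullback {x, y} (\<lambda>x. x) (unif X)\<rparr>"
  have "?S \<in> C"
    using X by (intro epireflective_subspace_mem[OF inf C]) auto
  \<comment> \<open>The two-point subspace is coarsened to the indiscrete one. Maps into it separate
    the points of \<open>Y\<close>, and an indiscrete uniformity lies above every filter confined to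
    its carrier.\<close>
  then have B: "indisc {x, y} \<in> C"
    by (rule bimorphic_image_mem[OF inf C(1) bi]) (simp_all add: pullback_le_principal[of "{x, y}", simplified])
  have hom: "restrict (\<lambda>w. if w = z then x else y) (points Y) \<in> hom Y (indisc {x, y})" for z
    using UnifD(1)[OF Y(1)] by (intro restrict_hom_indisc) auto
  show ?thesis
  proof (rule epireflective_mem[OF inf C Y(1)])
    show "\<exists>B\<in>C. \<exists>f\<in>hom Y B. f a \<noteq> f b" if "a \<in> points Y" "b \<in> points Y" "a \<noteq> b" for a b
      using that X(4) by (intro bexI[OF _ B] bexI[OF _ hom[of a]]) simp
  qed (use Y(2) in \<open>simp add: indiscrete_def\<close>)
qed

lemma epireflective_nonindiscrete_discrete_mem:
  fixes C :: "'u uspace set"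
  assumes inf: "infinite (UNIV :: 'u set)" and C: "subcategory C" "epireflective C"
    and X: "X \<in> C" "\<not> indiscrete X"
  obtains a b where "a \<noteq> b" "discrete {a, b} \<in> C"
proof -
  have us: "unif_space X"
    using C(1) X(1) UnifD(1) unfolding subcategory_def by blast
  have "\<not> principal (points X \<times> points X) \<le> unif X"
    using X(2) us indiscrete_unif_eq by blast
  then obtain E where E: "eventually E (unif X)"
    "\<not> eventually E (principal (points X \<times> points X))"
    by (auto simp: le_filter_def)
  then obtain a b where ab: "a \<in> points X" "b \<in> points X" "\<not> E (a, b)"
    by (auto simp: eventually_principal)
  \<comment> \<open>An entourage missing \<open>(a, b)\<close> is symmetrized so that it misses
    \<open>(b, a)\<close> as well; it then separates the two points.\<close>
  have D: "eventually (\<lambda>p. E p \<and> (\<lambda>(x, y). E (y, x)) p) (unif X)"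
    using E(1) unif_space_sym[OF us E(1)] by (rule eventually_conj)
  have "discrete {a, b} \<in> C"
    by (rule epireflective_discrete_mem[OF inf C X(1) _ D]) (use ab in auto)
  moreover have "a \<noteq> b"
    using unif_space_refl[OF us E(1)] ab by auto
  ultimately show thesis
    using that by blast
qed

section \<open>Classification by the discrete members\<close>

text \<open>Every uniformity is coarser than the discrete one on the same points.\<close>

lemma epireflective_all_discrete:
  fixes C :: "'u uspace set"
  assumes inf: "infinite (UNIV :: 'u set)" and C: "subcategory C"
    and bi: "closed_under_bimorphic_images C"
    and all: "\<And>A. small A \<Longrightarrow> discrete A \<in> C"
  shows "C = Unif"
proof
  show "C \<subseteq> Unif"
    using C unfolding subcategory_def by blast
  show "Unif \<subseteq> C"
  proof
    fix X :: "'u uspace" assume X: "X \<in> Unif"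
    then show "X \<in> C"
      using UnifD(1)[OF X] UnifD(2)[OF X]
      by (intro bimorphic_image_mem[OF inf C bi all[of "points X"]]) (auto simp: unif_space_iff)
  qed
qed

text \<open>
  Here \<open>|A|\<close> is the cardinal \<open>\<lambda>\<^sub>0\<close> of the theorem: a space with covering character at most \<open>|A|\<close> is a bimorphic image of the space with the same points whose uniformity is generated
  by all partitions into fewer than \<open>|A|\<close> classes.
\<close>

lemma epireflective_minimal_missing_discrete:
  fixes C :: "'u uspace set"
  assumes inf: "infinite (UNIV :: 'u set)" and C: "subcategory C" "epireflective C"
    and bi: "closed_under_bimorphic_images C"
    and A: "small A" "discrete A \<notin> C" "infinite A"
    and less: "\<And>B. |B| <o |A| \<Longrightarrow> discrete B \<in> C"
  shows "C = {X \<in> Unif. covering_character_le X |A|}"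
proof -
  have \<kappa>: "Cinfinite |A|"
    using A(3) by (simp add: cinfinite_def Field_card_of card_of_card_order_on)
  have "few_classes (points X) |A| (unif X)" if X: "X \<in> C" for X
  proof (rule ccontr)
    assume neg: "\<not> few_classes (points X) |A| (unif X)"
    have us: "unif_space X"
      using C(1) X UnifD(1) unfolding subcategory_def by blast
    obtain S D where S: "S \<subseteq> points X" "|A| \<le>o |S|" "eventually D (unif X)"
      "\<And>x y. x \<in> S \<Longrightarrow> y \<in> S \<Longrightarrow> D (x, y) \<Longrightarrow> x = y"
      using large_separated_set[OF us _ neg] \<kappa> by metis
    have "discrete S \<in> C"
      using epireflective_discrete_mem[OF inf C X S(1,3)] S(4) by blast
    then have "discrete A \<in> C"
      using S(2) by (rule epireflective_discrete_mono[OF inf C])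
    with A(2) show False ..
  qed
  moreover have "X \<in> C" if X: "X \<in> Unif" and few: "few_classes (points X) |A| (unif X)" for X
  proof -
    note us = UnifD(1)[OF X]
    let ?P = "{p :: 'u \<Rightarrow> 'u. |p ` points X| <o |A| }"
    \<comment> \<open>The initial uniformity for the labelling \<open>p\<close> into the discrete
      space of its labels, which belongs to \<open>C\<close> as there are fewer than
      \<open>|A|\<close> labels.\<close>
    define Fp where "Fp p = pullback (points X) p (principal (Id_on (p ` points X)))" for p :: "'u \<Rightarrow> 'u"
    define X' where "X' = \<lparr>points = points X, unif = \<Sqinter>p\<in>?P. Fp p\<rparr>"
    \<comment> \<open>A constant labelling shows that the family is nonempty, as needed for its
      supremum to be a uniformity.\<close>
    have "|(\<lambda>_. undefined :: 'u) ` points X| <o |A|"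
      using \<kappa> by (intro finite_ordLess_Cinfinite) (auto simp: image_constant_conv)
    then have "?P \<noteq> {}"
      by blast
    moreover have "unif_space \<lparr>points = points X, unif = Fp p\<rparr>" for p
      using unif_space_pullback[of "discrete (p ` points X)" p "points X"] by (simp add: Fp_def)
    ultimately have us': "unif_space X'"
      unfolding X'_def by (rule unif_space_INF)
    have hom: "restrict p (points X') \<in> hom X' (discrete (p ` points X))" if "p \<in> ?P" for p
      using that us' by (intro restrict_hom) (auto simp: X'_def Fp_def intro: INF_lower)
    have mem: "discrete (p ` points X) \<in> C" if "p \<in> ?P" for p
      using that less by blast
    have "X' \<in> C"
    proof (rule epireflective_mem[OF inf C])
      show "X' \<in> Unif"
        using us' UnifD(2)[OF X] by (simp add: Unif_def X'_def)
      show "\<exists>B\<in>C. \<exists>f\<in>hom X' B. f x \<noteq> f y" if xy: "x \<in> points X'" "y \<in> points X'" "x \<noteq> y" for x y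
      proof -
        \<comment> \<open>Two labels suffice to separate \<open>x\<close> from \<open>y\<close>, and
          \<open>|A|\<close> is infinite.\<close>
        let ?p = "\<lambda>z. if z = x then x else y"
        have "|?p ` points X| <o |A|"
          using \<kappa> by (intro finite_ordLess_Cinfinite finite_subset[of "?p ` points X" "{x, y}"]) auto
        then show ?thesis
          using xy by (intro bexI[OF _ mem[of ?p]] bexI[OF _ hom[of ?p]]) auto
      qed
      fix F
      assume le: "\<And>B f. B \<in> C \<Longrightarrow> f \<in> hom X' B \<Longrightarrow> F \<le> pullback (points X') f (unif B)"
      have "F \<le> Fp p" if "p \<in> ?P" for p
        using le[OF mem[OF that] hom[OF that]] by (simp add: X'_def Fp_def pullback_restrict)
      then show "F \<le> unif X'"
        by (simp add: X'_def le_INF_iff)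
    qed
    have "unif X' \<le> unif X"
    proof (rule filter_leI)
      fix E assume "eventually E (unif X)"
      then obtain p :: "'u \<Rightarrow> 'u" where p: "|p ` points X| <o |A|"
        "\<forall>x\<in>points X. \<forall>y\<in>points X. p x = p y \<longrightarrow> E (x, y)"
        using few_classesD[OF few] by blast
      have "eventually E (Fp p)"
        unfolding Fp_def eventually_pullback using p(2)
        by (intro exI[of _ "\<lambda>q. q \<in> Id_on (p ` points X)"]) (auto simp: eventually_principal)
      then show "eventually E (unif X')"
        using p(1) by (auto simp: X'_def intro: eventually_INF1)
    qed
    then show ?thesis
      by (intro bimorphic_image_mem[OF inf C(1) bi \<open>X' \<in> C\<close> us]) (auto simp: X'_def)
  qed
  moreover have "C \<subseteq> Unif"
    using C(1) unfolding subcategory_def by blast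
  ultimately show ?thesis
    using covering_character_le_iff[OF UnifD(1) \<kappa>] by blast
qed

lemma epireflective_imp_listed_form:
  fixes C :: "'u uspace set"
  assumes inf: "infinite (UNIV :: 'u set)" and C: "subcategory C" "epireflective C"
    and bi: "closed_under_bimorphic_images C"
  shows "listed_form C"
proof -
  have sub: "C \<subseteq> Unif"
    using C(1) unfolding subcategory_def by blast
  consider (one) "\<forall>X\<in>C. finite (points X) \<and> card (points X) \<le> 1"
    | (ind) X where "X \<in> C" "\<not> (finite (points X) \<and> card (points X) \<le> 1)" "\<forall>X\<in>C. indiscrete X"
    | (disc) X where "X \<in> C" "\<not> indiscrete X"
    by blast
  then show ?thesis
  proof cases
    case one
    then have "C = {X \<in> Unif. finite (points X) \<and> card (points X) \<le> 1}"
      using epireflective_subsingleton_mem[OF inf C] sub by blast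
    then show ?thesis by (simp add: listed_form_def)
  next
    case ind
    have "\<exists>x\<in>points X. \<exists>y\<in>points X. x \<noteq> y"
    proof (rule ccontr)
      assume "\<not> (\<exists>x\<in>points X. \<exists>y\<in>points X. x \<noteq> y)"
      then have "points X = {} \<or> (\<exists>x. points X = {x})"
        by blast
      with ind(2) show False by auto
    qed
    then have "C = {X \<in> Unif. indiscrete X}"
      using epireflective_bimorphic_indiscrete_mem[OF inf C bi ind(1)] ind(3) sub by blast
    then show ?thesis by (simp add: listed_form_def)
  next
    case disc
    then obtain a b where ab: "a \<noteq> b" "discrete {a, b} \<in> C"
      using epireflective_nonindiscrete_discrete_mem[OF inf C] by metis
    show ?thesis
    proof (cases "\<forall>A. small A \<longrightarrow> discrete A \<in> C")
      case True
      then have "C = Unif"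
        using epireflective_all_discrete[OF inf C(1) bi] by blast
      then show ?thesis by (simp add: listed_form_def)
    next
      case False
      \<comment> \<open>The least size of a missing discrete space serves as the cardinal. It is
        infinite because all finite discrete spaces are present, and it lies in the universe because
        it is attained by a small set.\<close>
      let ?R = "card_of ` {A :: 'u set. small A \<and> discrete A \<notin> C}"
      have "?R \<noteq> {}" "\<forall>r\<in>?R. Card_order r"
        using False by (auto intro: card_of_Card_order)
      then obtain A where A: "small A" "discrete A \<notin> C"
        and min: "\<And>B. small B \<Longrightarrow> discrete B \<notin> C \<Longrightarrow> |A| \<le>o |B|"
        using exists_minim_Card_order[of ?R] by auto
      have "infinite A"
        using A(2) epireflective_finite_discrete_mem[OF inf C ab(2,1)] by blast
      moreover have "discrete B \<in> C" if B: "|B| <o |A|" for B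
      proof (rule ccontr)
        assume "discrete B \<notin> C"
        moreover have "small B"
          using small_if_ordLeq[OF ordLess_imp_ordLeq[OF B] A(1)] .
        ultimately show False
          using min B not_ordLess_ordLeq by blast
      qed
      ultimately have "C = {X \<in> Unif. covering_character_le X |A| }"
        by (rule epireflective_minimal_missing_discrete[OF inf C bi A])
      moreover have "Cinfinite |A|"
        using \<open>infinite A\<close> by (simp add: cinfinite_def Field_card_of card_of_card_order_on)
      ultimately show ?thesis
        using A(1) unfolding listed_form_def small_def by blast
    qed
  qed
qed

section \<open>Reflections\<close>

text \<open>One surjective reflection per space suffices: surjectivity gives uniqueness of the
  factorizations, and any other reflection arrow of the same space inherits surjectivity by
  comparison.\<close>

lemma epireflectiveI:
  fixes C :: "'u uspace set"
  assumes inf: "infinite (UNIV :: 'u set)" and sub: "C \<subseteq> Unif"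
    and refl: "\<And>X. X \<in> Unif \<Longrightarrow> \<exists>A\<in>C. \<exists>r\<in>hom X A. r ` points X = points A \<and>
      (\<forall>B\<in>C. \<forall>f\<in>hom X B. \<exists>g\<in>hom A B. compose (points X) g r = f)"
  shows "epireflective C"
proof -
  have ex: "\<exists>A r. reflection_arrow C X A r \<and> r ` points X = points A" if X: "X \<in> Unif" for X
  proof -
    obtain A r where r: "A \<in> C" "r \<in> hom X A" "r ` points X = points A"
      and fact: "\<forall>B\<in>C. \<forall>f\<in>hom X B. \<exists>g\<in>hom A B. compose (points X) g r = f"
      using refl[OF X] by (elim bexE conjE) (rule that)
    have epi: "epimorphism X A r"
      using epimorphism_iff_surj[OF inf, of A X r] r sub UnifD(1) by blast
    have "\<exists>!g. g \<in> hom A B \<and> compose (points X) g r = f" if "B \<in> C" "f \<in> hom X B" for B f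
    proof -
      obtain g where "g \<in> hom A B" "compose (points X) g r = f"
        using fact \<open>B \<in> C\<close> \<open>f \<in> hom X B\<close> by blast
      moreover have "h = g" if "h \<in> hom A B" "compose (points X) h r = f" for h
        using epi that calculation \<open>B \<in> C\<close> sub unfolding epimorphism_def by blast
      ultimately show ?thesis by blast
    qed
    then show ?thesis
      using r unfolding reflection_arrow_def by blast
  qed
  have "epimorphism X A r" if X: "X \<in> Unif" and r: "reflection_arrow C X A r" for X A r
  proof -
    have A: "A \<in> C" "r \<in> hom X A" "unif_space A" "unif_space X"
      using r X sub UnifD(1) by (auto simp: reflection_arrow_def)
    obtain A' r' where r': "reflection_arrow C X A' r'" "r' ` points X = points A'"
      using ex[OF X] by blast
    then have A': "A' \<in> C" "r' \<in> hom X A'"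
      by (auto simp: reflection_arrow_def)
    obtain g where g: "g \<in> hom A' A" "compose (points X) g r' = r"
      using r'(1) A(1,2) unfolding reflection_arrow_def by blast
    obtain h where h: "h \<in> hom A A'" "compose (points X) h r = r'"
      using r A' unfolding reflection_arrow_def by blast
    have gr: "g (r' x) = r x" and hr: "h (r x) = r' x" if "x \<in> points X" for x
      using fun_cong[OF g(2), of x] fun_cong[OF h(2), of x] that by (simp_all add: compose_def)
    \<comment> \<open>Both \<open>h\<close> followed by \<open>g\<close> and the identity factor
      \<open>r\<close> through itself, so they are equal. Since \<open>r'\<close> is surjective,
      \<open>h a = r' x\<close> for some \<open>x\<close>, and then
      \<open>a = g (r' x) = r x\<close>.\<close>
    have "compose (points A) g h \<in> hom A A" "restrict (\<lambda>x. x) (points A) \<in> hom A A"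
      using compose_hom[OF A(3) h(1) g(1)] pullback_id[OF A(3)]
      by (auto intro!: restrict_hom A(3))
    moreover have "compose (points X) (compose (points A) g h) r = r"
      "compose (points X) (restrict (\<lambda>x. x) (points A)) r = r"
      using hom_points[OF A(2)] hom_extensional[OF A(2)]
      by (auto simp: compose_def fun_eq_iff gr hr extensional_def)
    moreover have "\<exists>!k. k \<in> hom A A \<and> compose (points X) k r = r"
      using r A(1,2) unfolding reflection_arrow_def by blast
    ultimately have gh: "compose (points A) g h = restrict (\<lambda>x. x) (points A)"
      by blast
    have "a \<in> r ` points X" if a: "a \<in> points A" for a
    proof -
      obtain x where "x \<in> points X" "h a = r' x"
        using r'(2) hom_points[OF h(1) a] by blast
      then have "r x = a"
        using gr fun_cong[OF gh, of a] a by (simp add: compose_def)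
      then show ?thesis
        using \<open>x \<in> points X\<close> by blast
    qed
    then have "r ` points X = points A"
      using hom_image[OF A(2)] by blast
    then show ?thesis
      using epimorphism_iff_surj[OF inf A(3)] A(2) by blast
  qed
  then show ?thesis
    using ex unfolding epireflective_def reflective_def by blast
qed

text \<open>The reflection keeps the points and takes the supremum of all coarser uniformities
  satisfying \<open>P\<close>. This covers the listed classes except the spaces with at most one
  point, whose reflections identify points.\<close>

lemma epireflective_initially_closed:
  fixes P :: "'u set \<Rightarrow> ('u \<times> 'u) filter \<Rightarrow> bool"
  assumes inf: "infinite (UNIV :: 'u set)"
    and indisc: "\<And>A. P A (principal (A \<times> A))"
    and INF: "\<And>A \<F>. (\<And>F. F \<in> \<F> \<Longrightarrow> P A F) \<Longrightarrow> \<F> \<noteq> {} \<Longrightarrow> P A (\<Sqinter> \<F>)"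
    and pull: "\<And>A B f G. P B G \<Longrightarrow> f ` A \<subseteq> B \<Longrightarrow> P A (pullback A f G)"
  shows "epireflective {X \<in> Unif. P (points X) (unif X)}"
proof (rule epireflectiveI[OF inf])
  fix X :: "'u uspace" assume X: "X \<in> Unif"
  note us = UnifD(1)[OF X]
  let ?C = "{X \<in> Unif. P (points X) (unif X)}"
  let ?\<F> = "{F. unif_space \<lparr>points = points X, unif = F\<rparr> \<and> unif X \<le> F \<and> P (points X) F}"
  let ?A = "\<lparr>points = points X, unif = \<Sqinter> ?\<F>\<rparr>"
  let ?r = "restrict (\<lambda>x. x) (points X)"
  have "principal (points X \<times> points X) \<in> ?\<F>"
    using unif_space_indisc[of "points X"] unif_space_le_principal[OF us] indisc
    by (simp add: indisc_def)
  then have "?\<F> \<noteq> {}"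
    by blast
  have usA: "unif_space ?A"
    using unif_space_INF[OF \<open>?\<F> \<noteq> {}\<close>, of "points X" "\<lambda>F. F"] by simp
  moreover have "P (points X) (\<Sqinter> ?\<F>)"
    by (rule INF[OF _ \<open>?\<F> \<noteq> {}\<close>]) simp
  ultimately have "?A \<in> ?C"
    using UnifD(2)[OF X] by (simp add: Unif_def)
  moreover have "?r \<in> hom X ?A"
  proof (rule restrict_hom[OF us])
    have "unif X \<le> unif ?A"
      by (auto intro: Inf_greatest)
    then show "unif X \<le> pullback (points X) (\<lambda>x. x) (unif ?A)"
      using pullback_id[OF usA] by simp
  qed simp
  moreover have "\<exists>g\<in>hom ?A B. compose (points X) g ?r = f" if B: "B \<in> ?C" and f: "f \<in> hom X B" for B f
  proof (rule bexI[of _ f])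
    have "unif_space B" "f ` points X \<subseteq> points B"
      using B UnifD(1) hom_image[OF f] by auto
    \<comment> \<open>The initial uniformity of \<open>f\<close> is one of those in the supremum, so
      \<open>f\<close> stays uniformly continuous on the reflection.\<close>
    then have "pullback (points X) f (unif B) \<in> ?\<F>"
      using B f us unif_space_pullback pull[of "points B"] by (auto simp: hom_iff)
    then have "unif ?A \<le> pullback (points X) f (unif B)"
      by (auto intro: Inf_lower)
    then show "f \<in> hom ?A B"
      using f us usA by (simp add: hom_iff)
    show "compose (points X) f ?r = f"
      using hom_extensional[OF f] by (auto simp: compose_def fun_eq_iff extensional_def)
  qed
  ultimately show "\<exists>A\<in>?C. \<exists>r\<in>hom X A. r ` points X = points A \<and>
      (\<forall>B\<in>?C. \<forall>f\<in>hom X B. \<exists>g\<in>hom A B. compose (points X) g r = f)"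
    by (intro bexI[of _ ?A] bexI[of _ ?r]) auto
qed simp

section \<open>The listed classes are epireflective\<close>

lemma epireflective_indiscrete:
  assumes "infinite (UNIV :: 'u set)"
  shows "epireflective {X :: 'u uspace. X \<in> Unif \<and> indiscrete X}"
  unfolding indiscrete_def
proof (rule epireflective_initially_closed[OF assms])
  fix A :: "'u set" and \<F>
  assume "\<And>F. F \<in> \<F> \<Longrightarrow> F = principal (A \<times> A)" "\<F> \<noteq> {}"
  then have "\<F> = {principal (A \<times> A)}"
    by blast
  then show "\<Sqinter> \<F> = principal (A \<times> A)"
    by simp
qed (simp_all add: pullback_indisc)

lemma epireflective_Unif:
  assumes "infinite (UNIV :: 'u set)"
  shows "epireflective (Unif :: 'u uspace set)"
  using epireflective_initially_closed[OF assms, of "\<lambda>_ _. True"] by simp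

lemma epireflective_covering_character_le:
  assumes "infinite (UNIV :: 'u set)" and \<kappa>: "Cinfinite (\<kappa> :: 'c rel)"
  shows "epireflective {X :: 'u uspace. X \<in> Unif \<and> covering_character_le X \<kappa>}"
proof -
  have "few_classes A \<kappa> (principal (A \<times> A))" for A :: "'u set"
  proof (rule few_classesI)
    fix E assume "eventually E (principal (A \<times> A))"
    moreover have "|(\<lambda>_. undefined :: 'u) ` A| <o \<kappa>"
      using \<kappa> by (intro finite_ordLess_Cinfinite) (auto simp: image_constant_conv)
    ultimately show "\<exists>p :: 'u \<Rightarrow> 'u. |p ` A| <o \<kappa> \<and> (\<forall>x\<in>A. \<forall>y\<in>A. p x = p y \<longrightarrow> E (x, y))"
      by (intro exI[of _ "\<lambda>_. undefined"]) (auto simp: eventually_principal)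
  qed
  then have "epireflective {X :: 'u uspace. X \<in> Unif \<and> few_classes (points X) \<kappa> (unif X)}"
    using few_classes_INF[OF \<kappa>, of _ _ "\<lambda>F. F", simplified] few_classes_pullback
    by (rule epireflective_initially_closed[OF assms(1)])
  moreover have "{X :: 'u uspace. X \<in> Unif \<and> covering_character_le X \<kappa>} =
      {X \<in> Unif. few_classes (points X) \<kappa> (unif X)}"
    using covering_character_le_iff[OF UnifD(1) \<kappa>] by blast
  ultimately show ?thesis
    by simp
qed

lemma epireflective_subsingleton:
  assumes inf: "infinite (UNIV :: 'u set)"
  shows "epireflective {X :: 'u uspace. X \<in> Unif \<and> finite (points X) \<and> card (points X) \<le> 1}"
proof (rule epireflectiveI[OF inf])
  fix X :: "'u uspace" assume X: "X \<in> Unif"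
  note us = UnifD(1)[OF X]
  let ?C = "{X :: 'u uspace. X \<in> Unif \<and> finite (points X) \<and> card (points X) \<le> 1}"
  define a where "a = (SOME x. x \<in> points X)"
  let ?r = "restrict (\<lambda>_. a) (points X)"
  \<comment> \<open>The image is used instead of \<open>{a}\<close> so that the empty space is
    reflected to itself, where \<open>a\<close> is an arbitrary value.\<close>
  let ?A = "indisc (?r ` points X)"
  have A: "?r ` points X \<subseteq> {a}"
    by auto
  then have fin: "finite (?r ` points X)"
    by (rule finite_subset) simp
  have "?A \<in> ?C"
    using fin small_finite[OF inf fin] card_mono[OF _ A] by simp
  moreover have "?r \<in> hom X ?A"
    using us by (intro restrict_hom_indisc) auto
  moreover have "\<exists>g\<in>hom ?A B. compose (points X) g ?r = f" if B: "B \<in> ?C" and f: "f \<in> hom X B" for B f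
  proof (rule bexI[of _ "restrict f (points ?A)"])
    have a: "a \<in> points X" if "x \<in> points X" for x
      using that unfolding a_def by (rule someI)
    have "f x = f y" if "x \<in> points X" "y \<in> points X" for x y
      using B hom_points[OF f] that card_le_Suc0_iff_eq[of "points B"] by auto
    then have "f a = f x" if "x \<in> points X" for x
      using a[OF that] that by blast
    then have "compose (points X) (restrict f (points ?A)) ?r x = f x" for x
      using hom_extensional[OF f] by (cases "x \<in> points X") (auto simp: compose_def extensional_def)
    then show "compose (points X) (restrict f (points ?A)) ?r = f"
      by blast
    \<comment> \<open>On at most one point the indiscrete space is discrete, so every map out of it
      is a morphism.\<close>
    have "?A = discrete (?r ` points X)"
      using A by (auto simp: indisc_def discrete_def intro!: arg_cong[of _ _ principal])
    then show "restrict f (points ?A) \<in> hom ?A B"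
      using B UnifD(1)[of B] a hom_points[OF f] restrict_hom_discrete[of B f "?r ` points X"] by auto
  qed
  ultimately show "\<exists>A\<in>?C. \<exists>r\<in>hom X A. r ` points X = points A \<and>
      (\<forall>B\<in>?C. \<forall>f\<in>hom X B. \<exists>g\<in>hom A B. compose (points X) g r = f)"
    by (intro bexI[of _ ?A] bexI[of _ ?r]) auto
qed auto

lemma listed_form_imp_epireflective:
  fixes C :: "'u uspace set"
  assumes inf: "infinite (UNIV :: 'u set)" and "listed_form C"
  shows "epireflective C"
  using assms(2) epireflective_subsingleton[OF inf] epireflective_indiscrete[OF inf]
    epireflective_covering_character_le[OF inf] epireflective_Unif[OF inf]
  unfolding listed_form_def by blast

section \<open>Bimorphic images within the listed classes\<close>

lemma closed_under_bimorphic_imagesI: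
  fixes C :: "'u uspace set"
  assumes inf: "infinite (UNIV :: 'u set)" and sub: "C \<subseteq> Unif"
    and img: "\<And>X Y f. X \<in> C \<Longrightarrow> Y \<in> Unif \<Longrightarrow> f \<in> hom X Y \<Longrightarrow> bij_betw f (points X) (points Y) \<Longrightarrow> Y \<in> C"
  shows "closed_under_bimorphic_images C"
  unfolding closed_under_bimorphic_images_def
proof (intro ballI allI impI)
  fix X Y e assume "X \<in> C" "Y \<in> Unif" "bimorphism X Y e"
  then show "Y \<in> C"
    using img[of X Y e] bimorphism_iff_bij[OF inf, of X Y e] sub UnifD(1) by blast
qed

text \<open>A labelling of \<open>X\<close> is transported to \<open>Y\<close> along a section of
  \<open>f\<close>; the section need not be uniformly continuous.\<close>

lemma few_classes_image:
  fixes X Y :: "'u uspace"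
  assumes "f \<in> hom X Y" "f ` points X = points Y" "few_classes (points X) \<kappa> (unif X)"
  shows "few_classes (points Y) \<kappa> (unif Y)"
proof (rule few_classesI)
  fix E assume "eventually E (unif Y)"
  then have "eventually (\<lambda>(x, y). E (f x, f y)) (unif X)"
    by (rule hom_eventually[OF assms(1)])
  from few_classesD[OF assms(3) this] obtain p :: "'u \<Rightarrow> 'u" where p: "|p ` points X| <o \<kappa>"
    "\<forall>x\<in>points X. \<forall>y\<in>points X. p x = p y \<longrightarrow> E (f x, f y)"
    by auto
  let ?s = "inv_into (points X) f"
  have s: "?s y \<in> points X" "f (?s y) = y" if "y \<in> points Y" for y
    using that assms(2) by (auto simp: inv_into_into f_inv_into_f)
  have "|(p \<circ> ?s) ` points Y| \<le>o |p ` points X|"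
    using s by (intro card_of_mono1) auto
  then have "|(p \<circ> ?s) ` points Y| <o \<kappa>"
    using p(1) by (rule ordLeq_ordLess_trans)
  moreover have "E (x, y)" if "x \<in> points Y" "y \<in> points Y" "p (?s x) = p (?s y)" for x y
    using p(2) s that by metis
  ultimately show "\<exists>p :: 'u \<Rightarrow> 'u. |p ` points Y| <o \<kappa> \<and> (\<forall>x\<in>points Y. \<forall>y\<in>points Y. p x = p y \<longrightarrow> E (x, y))"
    by (intro exI[of _ "p \<circ> ?s"]) auto
qed

lemma listed_form_imp_closed_under_bimorphic_images:
  fixes C :: "'u uspace set"
  assumes inf: "infinite (UNIV :: 'u set)" and "listed_form C"
  shows "closed_under_bimorphic_images C"
proof (rule closed_under_bimorphic_imagesI[OF inf])
  show "C \<subseteq> Unif"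
    using assms(2) unfolding listed_form_def by blast
  fix X Y :: "'u uspace" and f
  assume X: "X \<in> C" and Y: "Y \<in> Unif" and f: "f \<in> hom X Y" "bij_betw f (points X) (points Y)"
  have surj: "f ` points X = points Y"
    using f(2) by (simp add: bij_betw_def)
  have "finite (points Y) \<and> card (points Y) \<le> 1" if "finite (points X)" "card (points X) \<le> 1"
    using that f(2) by (simp add: bij_betw_finite bij_betw_same_card)
  moreover have "indiscrete Y" if "indiscrete X"
  proof (rule indiscrete_unif_eq[OF UnifD(1)[OF Y]], rule filter_leI)
    fix E assume "eventually E (unif Y)"
    then have "eventually (\<lambda>(x, y). E (f x, f y)) (unif X)"
      by (rule hom_eventually[OF f(1)])
    then show "eventually E (principal (points Y \<times> points Y))"
      using that surj by (auto simp: indiscrete_def eventually_principal simp flip: surj)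
  qed
  moreover have "covering_character_le Y \<kappa>"
    if "Cinfinite \<kappa>" "covering_character_le X \<kappa>" "X \<in> Unif" for \<kappa> :: "'u rel"
    using few_classes_image[OF f(1) surj] that covering_character_le_iff UnifD(1) Y by blast
  ultimately show "Y \<in> C"
    using assms(2) X Y unfolding listed_form_def by blast
qed

lemma epireflective_bimorphic_iff_listed_form:
  fixes C :: "'u uspace set"
  assumes "infinite (UNIV :: 'u set)" "subcategory C"
  shows "epireflective C \<and> closed_under_bimorphic_images C \<longleftrightarrow> listed_form C"
  using epireflective_imp_listed_form[OF assms] listed_form_imp_epireflective[OF assms(1)]
    listed_form_imp_closed_under_bimorphic_images[OF assms(1)] by blast

section \<open>Independence of the three closure properties\<close>

lemma isomorphism_sym: "isomorphism X Y f \<Longrightarrow> \<exists>g. isomorphism Y X g"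
  unfolding isomorphism_def by blast

text \<open>Isomorphisms are bimorphisms, so closedness under isomorphisms comes for free.\<close>

lemma subcategory_if_closed_under_bimorphic_images:
  fixes C :: "'u uspace set"
  assumes inf: "infinite (UNIV :: 'u set)" and sub: "C \<subseteq> Unif" and "closed_under_bimorphic_images C"
  shows "subcategory C"
  unfolding subcategory_def
proof (intro conjI ballI allI impI)
  fix X Y f assume X: "X \<in> C" and Y: "Y \<in> Unif" and f: "isomorphism X Y f"
  have "unif_space X" "unif_space Y"
    using X Y sub UnifD(1) by blast+
  then have "bimorphism X Y f"
    using isomorphism_bij[OF f] by (simp add: bimorphism_iff_bij[OF inf])
  then show "Y \<in> C"
    using assms(3) X Y unfolding closed_under_bimorphic_images_def by blast
qed (rule sub)

section \<open>Three counterexample classes\<close>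

text \<open>The witness for omitting closedness under products.\<close>

definition at_most_two :: "'u uspace set" where
  "at_most_two = {X \<in> Unif. finite (points X) \<and> card (points X) \<le> 2}"

text \<open>The witness for omitting closedness under extremal subobjects: only the empty subspace
  is lost.\<close>

definition nonempty_spaces :: "'u uspace set" where
  "nonempty_spaces = {X \<in> Unif. points X \<noteq> {}}"

text \<open>The Hausdorff uniform spaces, the witness for omitting closedness under bimorphic
  images.\<close>

definition separated_spaces :: "'u uspace set" where
  "separated_spaces = {X \<in> Unif. \<forall>x\<in>points X. \<forall>y\<in>points X.
     x \<noteq> y \<longrightarrow> (\<exists>E. eventually E (unif X) \<and> \<not> E (x, y))}"

text \<open>Separating entourages pull back along injective morphisms. This gives closedness both
  under isomorphisms and under extremal subobjects.\<close>

lemma separated_spaces_injective: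
  assumes "X \<in> Unif" "Y \<in> separated_spaces" "f \<in> hom X Y" "inj_on f (points X)"
  shows "X \<in> separated_spaces"
proof -
  have "\<exists>E. eventually E (unif X) \<and> \<not> E (x, y)"
    if xy: "x \<in> points X" "y \<in> points X" "x \<noteq> y" for x y
  proof -
    have "f x \<noteq> f y" "f x \<in> points Y" "f y \<in> points Y"
      using xy assms(4) hom_points[OF assms(3)] by (auto dest: inj_onD)
    then obtain E where E: "eventually E (unif Y)" "\<not> E (f x, f y)"
      using assms(2) unfolding separated_spaces_def by blast
    show ?thesis
      using hom_eventually[OF assms(3) E(1)] E(2) by (intro exI[of _ "\<lambda>(x, y). E (f x, f y)"]) simp
  qed
  with assms(1) show ?thesis
    by (simp add: separated_spaces_def)
qed

lemma at_most_two_closed: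
  assumes inf: "infinite (UNIV :: 'u set)"
  shows "subcategory (at_most_two :: 'u uspace set)"
    and "closed_under_extremal_subobjects (at_most_two :: 'u uspace set)"
    and "closed_under_bimorphic_images (at_most_two :: 'u uspace set)"
    and "\<not> listed_form (at_most_two :: 'u uspace set)"
proof -
  have bij: "Y \<in> at_most_two"
    if "X \<in> at_most_two" "Y \<in> Unif" "bij_betw f (points X) (points Y)" for X Y :: "'u uspace" and f
    using that by (simp add: at_most_two_def bij_betw_finite bij_betw_same_card)
  have sub_Unif: "at_most_two \<subseteq> (Unif :: 'u uspace set)"
    by (auto simp: at_most_two_def)
  show bi: "closed_under_bimorphic_images (at_most_two :: 'u uspace set)"
    by (rule closed_under_bimorphic_imagesI[OF inf sub_Unif bij])
  show sub: "subcategory (at_most_two :: 'u uspace set)"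
    by (rule subcategory_if_closed_under_bimorphic_images[OF inf sub_Unif bi])
  show "closed_under_extremal_subobjects (at_most_two :: 'u uspace set)"
    unfolding closed_under_extremal_subobjects_def
  proof (intro ballI allI impI)
    fix X Y :: "'u uspace" and m
    assume Y: "Y \<in> at_most_two" and X: "X \<in> Unif" and m: "extremal_monomorphism X Y m"
    have "m \<in> hom X Y" "inj_on m (points X)"
      using m monomorphism_iff_inj[OF inf UnifD(1)[OF X]] by (auto simp: extremal_monomorphism_def)
    then show "X \<in> at_most_two"
      using X Y hom_image[of m X Y] card_inj_on_le[of m "points X" "points Y"]
      by (auto simp: at_most_two_def intro: inj_on_finite)
  qed
  show "\<not> listed_form (at_most_two :: 'u uspace set)"
  proof
    assume "listed_form (at_most_two :: 'u uspace set)"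
    then have epi: "epireflective (at_most_two :: 'u uspace set)"
      using epireflective_bimorphic_iff_listed_form[OF inf sub] by blast
    \<comment> \<open>A class of a listed form is epireflective, so the two-point discrete space in
      it would bring along the discrete space on the three points of \<open>T\<close>.\<close>
    obtain T :: "'u set" where T: "finite T" "card T = 3"
      using infinite_arbitrarily_large[OF inf] by blast
    obtain a b c where "T = {a, b, c}" "a \<noteq> b"
      using T(2) by (auto simp: card_Suc_eq numeral_3_eq_3)
    have "card {a, b} = 2" "small {a, b}"
      using \<open>a \<noteq> b\<close> small_finite[OF inf] by auto
    then have "discrete {a, b} \<in> at_most_two"
      by (simp add: at_most_two_def)
    from epireflective_finite_discrete_mem[OF inf sub epi this \<open>a \<noteq> b\<close> T(1)] show False
      using T by (simp add: at_most_two_def)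
  qed
qed

lemma is_product_universal:
  assumes "is_product I X P p" "Y \<in> Unif" "\<forall>i\<in>I. f i \<in> hom Y (X i)"
  shows "\<exists>!h. h \<in> hom Y P \<and> (\<forall>i\<in>I. compose (points Y) (p i) h = f i)"
  using assms(1)[unfolded is_product_def, THEN conjunct2, THEN conjunct2, rule_format, OF assms(2)]
    assms(3) by blast

lemma nonempty_spaces_closed:
  assumes inf: "infinite (UNIV :: 'u set)"
  shows "subcategory (nonempty_spaces :: 'u uspace set)"
    and "closed_under_products (nonempty_spaces :: 'u uspace set)"
    and "closed_under_bimorphic_images (nonempty_spaces :: 'u uspace set)"
    and "\<not> listed_form (nonempty_spaces :: 'u uspace set)"
proof -
  have bij: "Y \<in> nonempty_spaces"
    if "X \<in> nonempty_spaces" "Y \<in> Unif" "bij_betw f (points X) (points Y)" for X Y :: "'u uspace" and f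
    using that by (auto simp: nonempty_spaces_def bij_betw_def)
  have sub_Unif: "nonempty_spaces \<subseteq> (Unif :: 'u uspace set)"
    by (auto simp: nonempty_spaces_def)
  show bi: "closed_under_bimorphic_images (nonempty_spaces :: 'u uspace set)"
    by (rule closed_under_bimorphic_imagesI[OF inf sub_Unif bij])
  show sub: "subcategory (nonempty_spaces :: 'u uspace set)"
    by (rule subcategory_if_closed_under_bimorphic_images[OF inf sub_Unif bi])
  show "closed_under_products (nonempty_spaces :: 'u uspace set)"
    unfolding closed_under_products_def
  proof (intro allI impI; elim conjE)
    fix I and X :: "'u \<Rightarrow> 'u uspace" and P p
    assume X: "\<forall>i\<in>I. X i \<in> nonempty_spaces" and P: "is_product I X P p"
    \<comment> \<open>A choice of points in the factors is a family of morphisms from a one-point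
      space; the universal property turns it into a point of \<open>P\<close>, without any
      construction of the product.\<close>
    let ?Y = "discrete {undefined :: 'u}"
    have Y: "?Y \<in> Unif"
      using small_finite[OF inf] by simp
    have f: "\<forall>i\<in>I. restrict (\<lambda>_. SOME x. x \<in> points (X i)) {undefined} \<in> hom ?Y (X i)"
      using X UnifD(1) by (auto simp: nonempty_spaces_def some_in_eq intro!: restrict_hom_discrete)
    from is_product_universal[OF P Y f] obtain h where "h \<in> hom ?Y P"
      by blast
    then show "P \<in> nonempty_spaces"
      using P hom_points[of h ?Y P undefined] by (auto simp: is_product_def nonempty_spaces_def)
  qed
  show "\<not> listed_form (nonempty_spaces :: 'u uspace set)"
  proof
    assume "listed_form (nonempty_spaces :: 'u uspace set)"
    then have "epireflective (nonempty_spaces :: 'u uspace set)"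
      using epireflective_bimorphic_iff_listed_form[OF inf sub] by blast
    \<comment> \<open>Every epireflective subcategory contains the empty space, as a space with at
      most one point.\<close>
    then have "discrete {} \<in> (nonempty_spaces :: 'u uspace set)"
      using small_finite[OF inf] by (intro epireflective_subsingleton_mem[OF inf sub]) auto
    then show False
      by (simp add: nonempty_spaces_def)
  qed
qed

lemma separated_spaces_closed:
  assumes inf: "infinite (UNIV :: 'u set)"
  shows "subcategory (separated_spaces :: 'u uspace set)"
    and "closed_under_products (separated_spaces :: 'u uspace set)"
    and "closed_under_extremal_subobjects (separated_spaces :: 'u uspace set)"
    and "\<not> listed_form (separated_spaces :: 'u uspace set)"
proof -
  have sub_Unif: "separated_spaces \<subseteq> (Unif :: 'u uspace set)"
    by (auto simp: separated_spaces_def)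
  have "Y \<in> separated_spaces" if Y: "X \<in> separated_spaces" "Y \<in> Unif" "isomorphism X Y f"
    for X Y :: "'u uspace" and f
  proof -
    obtain g where "isomorphism Y X g"
      using isomorphism_sym[OF Y(3)] by blast
    then show ?thesis
      using Y separated_spaces_injective isomorphism_bij[of Y X g] by (auto simp: bij_betw_def)
  qed
  then show sub: "subcategory (separated_spaces :: 'u uspace set)"
    using sub_Unif unfolding subcategory_def by blast
  show "closed_under_extremal_subobjects (separated_spaces :: 'u uspace set)"
    unfolding closed_under_extremal_subobjects_def extremal_monomorphism_def
    using separated_spaces_injective monomorphism_iff_inj[OF inf UnifD(1)] by blast
  show "closed_under_products (separated_spaces :: 'u uspace set)"
    unfolding closed_under_products_def
  proof (intro allI impI; elim conjE)
    fix I and X :: "'u \<Rightarrow> 'u uspace" and P p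
    assume X: "\<forall>i\<in>I. X i \<in> separated_spaces" and prod: "is_product I X P p"
    then have P: "P \<in> Unif" and p: "\<And>i. i \<in> I \<Longrightarrow> p i \<in> hom P (X i)"
      by (auto simp: is_product_def)
    have "\<exists>E. eventually E (unif P) \<and> \<not> E (x, y)"
      if xy: "x \<in> points P" "y \<in> points P" "x \<noteq> y" for x y
    proof -
      \<comment> \<open>The projections are jointly injective: otherwise \<open>x\<close> and
        \<open>y\<close>, viewed as morphisms from a one-point space, would be two factorizations of
        the same family.\<close>
      have "\<exists>i\<in>I. p i x \<noteq> p i y"
      proof (rule ccontr)
        assume "\<not> (\<exists>i\<in>I. p i x \<noteq> p i y)"
        then have eq: "p i y = p i x" if "i \<in> I" for i
          using that by simp
        let ?Y = "discrete {x}"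
        let ?f = "\<lambda>i. restrict (\<lambda>_. p i x) {x}"
        let ?g = "\<lambda>z. restrict (\<lambda>_. z) {x}"
        have Y: "?Y \<in> Unif"
          using small_finite[OF inf] by simp
        have f: "\<forall>i\<in>I. ?f i \<in> hom ?Y (X i)"
          using X sub_Unif UnifD(1) hom_points[OF p xy(1)]
          by (intro ballI restrict_hom_discrete) auto
        have "\<exists>!h. h \<in> hom ?Y P \<and> (\<forall>i\<in>I. compose (points ?Y) (p i) h = ?f i)"
          by (rule is_product_universal[OF prod Y f])
        moreover have "?g x \<in> hom ?Y P" "?g y \<in> hom ?Y P"
          using xy UnifD(1)[OF P] by (auto intro!: restrict_hom_discrete)
        moreover have "\<forall>i\<in>I. compose (points ?Y) (p i) (?g x) = ?f i"
          "\<forall>i\<in>I. compose (points ?Y) (p i) (?g y) = ?f i"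
          using eq by (auto simp: compose_def fun_eq_iff)
        ultimately have "?g x = ?g y"
          by blast
        from fun_cong[OF this, of x] show False
          using xy(3) by simp
      qed
      then obtain i where i: "i \<in> I" "p i x \<noteq> p i y"
        by blast
      then obtain E where E: "eventually E (unif (X i))" "\<not> E (p i x, p i y)"
        using X xy hom_points[OF p[OF i(1)]] unfolding separated_spaces_def by blast
      show ?thesis
        using hom_eventually[OF p[OF i(1)] E(1)] E(2)
        by (intro exI[of _ "\<lambda>(x, y). E (p i x, p i y)"]) simp
    qed
    then show "P \<in> separated_spaces"
      using P by (simp add: separated_spaces_def)
  qed
  show "\<not> listed_form (separated_spaces :: 'u uspace set)"
  proof
    assume "listed_form (separated_spaces :: 'u uspace set)"
    then have bi: "closed_under_bimorphic_images (separated_spaces :: 'u uspace set)"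
      using epireflective_bimorphic_iff_listed_form[OF inf sub] by blast
    obtain a b :: 'u where "a \<noteq> b"
      using ex_new_if_finite[OF inf, of "{undefined}"] by auto
    have "discrete {a, b} \<in> separated_spaces"
      using small_finite[OF inf]
      by (auto simp: separated_spaces_def eventually_principal intro!: exI[of _ "\<lambda>(x, y). x = y"])
    \<comment> \<open>The identity from the discrete to the indiscrete two-point space is a
      bimorphism that destroys separation.\<close>
    then have "indisc {a, b} \<in> separated_spaces"
      by (rule bimorphic_image_mem[OF inf sub bi]) auto
    then show False
      using \<open>a \<noteq> b\<close> by (auto simp: separated_spaces_def eventually_principal)
  qed
qed

theorem theorem3:
  assumes "infinite (UNIV :: 'u set)"
  shows
    "(\<forall>\<C> :: 'u uspace set. subcategory \<C> \<longrightarrow>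
        (epireflective \<C> \<and> closed_under_bimorphic_images \<C> \<longleftrightarrow> listed_form \<C>)) \<and>
     (\<exists>\<C> :: 'u uspace set. subcategory \<C> \<and>
        closed_under_extremal_subobjects \<C> \<and> closed_under_bimorphic_images \<C> \<and> \<not> listed_form \<C>) \<and>
     (\<exists>\<C> :: 'u uspace set. subcategory \<C> \<and>
        closed_under_products \<C> \<and> closed_under_bimorphic_images \<C> \<and> \<not> listed_form \<C>) \<and>
     (\<exists>\<C> :: 'u uspace set. subcategory \<C> \<and>
        closed_under_products \<C> \<and> closed_under_extremal_subobjects \<C> \<and> \<not> listed_form \<C>)"
  using epireflective_bimorphic_iff_listed_form[OF assms] at_most_two_closed[OF assms]
    nonempty_spaces_closed[OF assms] separated_spaces_closed[OF assms]
  by blast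

end
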